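(* Let $W$ be a Coxeter group generated by $\{s_i:i\in I\}$, let $\mathbf d=(d_i)_{i\in I}$ be integers with $d_i\geqslant 2$, and let $1\leqslant k\leqslant\infty$. Consider equivalence classes of strings (finite words) in the letters $s_i$, where two strings are equivalent if one can be reached from the other by applying the braid relations finitely many times. Let $S$ denote the set of classes such that no string in the class contains any of the substrings $s_i^{d_i}$ $(i\in I)$ or any of the braid words of length $k$ or more. Then the monomials in the $\mathbf s_i$ corresponding to any choice of class representatives from $S$ form a free $\Bbbk$-module basis of the nil-Hecke algebra $n\mathcal H(W,\mathbf d,J_{<k})$.
   Context: $\Bbbk$ is a fixed unital commutative ring. A Coxeter group $W$ has a finite index set $I$ of simple reflections $s_i$ and a Coxeter matrix $(m_{ij})_{i,j\in I}$ with $m_{ii}=1$ and $m_{ij}=m_{ji}\in\{2,3,\dots,\infty\}$ for $i\ne j$. Let $J$ be the set of unordered pairs $\{a,b\}\subset I$, $a\neq b$, with $m_{ab}<\infty$. For $j=\{a,b\}\in J$ let $\mathbf v_j=\mathbf s_a\mathbf s_b\mathbf s_a\cdots$ and $\mathbf w_j=\mathbf s_b\mathbf s_a\mathbf s_b\cdots$ be the two alternating words with $m_{ab}$ letters each. These are the braid words, of length $\ell(\mathbf v_j)=\ell(\mathbf w_j)=m_{ab}$; the braid relations (including commutations, $m_{ab}=2$) replace a consecutive substring $\mathbf v_j$ by $\mathbf w_j$ or vice versa, for $j\in J$ (with $\mathbf s_i$ read as $s_i$ for strings in the $s_i$). For $J_0\subset J$ and $\mathbf d=(d_i)_{i\in I}$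 with integers $d_i\geqslant 2$, the nil-Hecke algebra $n\mathcal H(W,\mathbf d,J_0)$ is the associative unital $\Bbbk$-algebra generated by $\{\mathbf s_i:i\in I\}$ with relations $$\mathbf s_i^{d_i}=0\ (i\in I),\qquad \mathbf v_j=\mathbf w_j\ (j\in J_0),\qquad \mathbf v_j=0=\mathbf w_j\ (j\in J\setminus J_0).$$ For $k\geqslant 1$ put $J_{<k}=\{j\in J:\ell(\mathbf v_j)<k\}$, and $J_{<\infty}=J$. The monomial corresponding to a string $s_{i_1}\cdots s_{i_r}$ is $\mathbf s_{i_1}\cdots\mathbf s_{i_r}$. *)

theory Defs
  imports
    "HOL-Algebra.QuotRing"
    "HOL-Algebra.Module"
    "HOL-Library.Sublist"
    "HOL-Library.Extended_Nat"
begin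

section \<open>Coxeter matrices, words and braid relations\<close>

text \<open>
  A Coxeter group is given through its Coxeter matrix \<open>m\<close> on a finite index set \<open>I\<close>; only the
  values of \<open>m\<close> on \<open>I\<close> matter. Strings in the letters \<open>s\<^sub>i\<close> are elements of
  \<^term>\<open>lists I\<close>, the letter \<open>s\<^sub>i\<close> being encoded by its index \<open>i\<close>.
\<close>

definition coxeter_matrix :: "'i set \<Rightarrow> ('i \<Rightarrow> 'i \<Rightarrow> enat) \<Rightarrow> bool" where
  "coxeter_matrix I m \<longleftrightarrow>
     (\<forall>i\<in>I. m i i = 1) \<and> (\<forall>i\<in>I. \<forall>j\<in>I. i \<noteq> j \<longrightarrow> m i j = m j i \<and> 2 \<le> m i j)"

fun alternating_word :: "nat \<Rightarrow> 'i \<Rightarrow> 'i \<Rightarrow> 'i list" where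
  "alternating_word 0 a b = []"
| "alternating_word (Suc n) a b = a # alternating_word n b a"

text \<open>
  For \<open>j = {a, b}\<close>, the two words \<open>v\<^sub>j\<close>, \<open>w\<^sub>j\<close> are \<open>braid_word m a b\<close> and \<open>braid_word m b a\<close>;
  which is which depends on the chosen ordering of the pair, so every notion below ranges
  over both orderings. The value is meaningful only if \<open>m a b < \<infinity>\<close>.
\<close>

definition braid_word :: "('i \<Rightarrow> 'i \<Rightarrow> enat) \<Rightarrow> 'i \<Rightarrow> 'i \<Rightarrow> 'i list" where
  "braid_word m a b = alternating_word (the_enat (m a b)) a b"

definition finite_pairs :: "'i set \<Rightarrow> ('i \<Rightarrow> 'i \<Rightarrow> enat) \<Rightarrow> 'i set set" where
  "finite_pairs I m = {{a, b} | a b. a \<in> I \<and> b \<in> I \<and> a \<noteq> b \<and> m a b < \<infinity>}"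

definition finite_pairs_less :: "'i set \<Rightarrow> ('i \<Rightarrow> 'i \<Rightarrow> enat) \<Rightarrow> enat \<Rightarrow> 'i set set" where
  "finite_pairs_less I m k =
     {{a, b} | a b. {a, b} \<in> finite_pairs I m \<and> enat (length (braid_word m a b)) < k}"

definition braid_move :: "'i set \<Rightarrow> ('i \<Rightarrow> 'i \<Rightarrow> enat) \<Rightarrow> ('i list \<times> 'i list) set" where
  "braid_move I m =
     {(x @ braid_word m a b @ y, x @ braid_word m b a @ y) | x y a b.
        x \<in> lists I \<and> y \<in> lists I \<and> {a, b} \<in> finite_pairs I m}"

text \<open>\<^term>\<open>braid_move I m\<close> is symmetric, so its reflexive transitive closure is an
  equivalence relation.\<close>

definition braid_classes :: "'i set \<Rightarrow> ('i \<Rightarrow> 'i \<Rightarrow> enat) \<Rightarrow> 'i list set set" where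
  "braid_classes I m = lists I // (braid_move I m)\<^sup>*"

definition admissible_classes ::
  "'i set \<Rightarrow> ('i \<Rightarrow> 'i \<Rightarrow> enat) \<Rightarrow> ('i \<Rightarrow> nat) \<Rightarrow> enat \<Rightarrow> 'i list set set" where
  "admissible_classes I m d k =
     {C \<in> braid_classes I m. \<forall>w\<in>C.
        (\<forall>i\<in>I. \<not> sublist (replicate (d i) i) w) \<and>
        (\<forall>a b. {a, b} \<in> finite_pairs I m \<and> k \<le> enat (length (braid_word m a b))
           \<longrightarrow> \<not> sublist (braid_word m a b) w)}"


section \<open>The free associative algebra\<close>

text \<open>
  Elements are the finitely supported functions from words over \<open>I\<close> to coefficients (total
  functions on lists, zero outside the support).
\<close>

definition free_algebra ::
  "('k, 'q) ring_scheme \<Rightarrow> 'i set \<Rightarrow> ('k, 'i list \<Rightarrow> 'k) module" where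
  "free_algebra R I =
     \<lparr> carrier = {f. (\<forall>w. f w \<in> carrier R) \<and> finite {w. f w \<noteq> \<zero>\<^bsub>R\<^esub>} \<and> {w. f w \<noteq> \<zero>\<^bsub>R\<^esub>} \<subseteq> lists I},
       monoid.mult = (\<lambda>f g w. \<Oplus>\<^bsub>R\<^esub>n\<in>{..length w}. f (take n w) \<otimes>\<^bsub>R\<^esub> g (drop n w)),
       one = (\<lambda>w. if w = [] then \<one>\<^bsub>R\<^esub> else \<zero>\<^bsub>R\<^esub>),
       ring.zero = (\<lambda>w. \<zero>\<^bsub>R\<^esub>),
       ring.add = (\<lambda>f g w. f w \<oplus>\<^bsub>R\<^esub> g w),
       smult = (\<lambda>c f w. c \<otimes>\<^bsub>R\<^esub> f w) \<rparr>"

definition free_word :: "('k, 'q) ring_scheme \<Rightarrow> 'i list \<Rightarrow> 'i list \<Rightarrow> 'k" where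
  "free_word R u = (\<lambda>w. if w = u then \<one>\<^bsub>R\<^esub> else \<zero>\<^bsub>R\<^esub>)"


section \<open>The nil-Hecke algebra\<close>

definition quotient_algebra ::
  "('k, 'a, 'q) module_scheme \<Rightarrow> 'a set \<Rightarrow> ('k, 'a set) module" where
  "quotient_algebra A K =
     ring.extend (A Quot K) (module.fields (\<lambda>c X. \<Union>x\<in>X. K +>\<^bsub>A\<^esub> (c \<odot>\<^bsub>A\<^esub> x)))"

definition nil_hecke_relators ::
  "('k, 'q) ring_scheme \<Rightarrow> 'i set \<Rightarrow> ('i \<Rightarrow> 'i \<Rightarrow> enat) \<Rightarrow> ('i \<Rightarrow> nat) \<Rightarrow> 'i set set
     \<Rightarrow> ('i list \<Rightarrow> 'k) set" where
  "nil_hecke_relators R I m d J\<^sub>0 =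
     {free_word R (replicate (d i) i) | i. i \<in> I} \<union>
     {free_word R (braid_word m a b) \<ominus>\<^bsub>free_algebra R I\<^esub> free_word R (braid_word m b a) | a b.
        {a, b} \<in> J\<^sub>0} \<union>
     {free_word R (braid_word m a b) | a b. {a, b} \<in> finite_pairs I m - J\<^sub>0}"

definition nil_hecke_ideal ::
  "('k, 'q) ring_scheme \<Rightarrow> 'i set \<Rightarrow> ('i \<Rightarrow> 'i \<Rightarrow> enat) \<Rightarrow> ('i \<Rightarrow> nat) \<Rightarrow> 'i set set
     \<Rightarrow> ('i list \<Rightarrow> 'k) set" where
  "nil_hecke_ideal R I m d J\<^sub>0 = Idl\<^bsub>free_algebra R I\<^esub> (nil_hecke_relators R I m d J\<^sub>0)"

definition nil_hecke ::
  "('k, 'q) ring_scheme \<Rightarrow> 'i set \<Rightarrow> ('i \<Rightarrow> 'i \<Rightarrow> enat) \<Rightarrow> ('i \<Rightarrow> nat) \<Rightarrow> 'i set set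
     \<Rightarrow> ('k, ('i list \<Rightarrow> 'k) set) module" where
  "nil_hecke R I m d J\<^sub>0 = quotient_algebra (free_algebra R I) (nil_hecke_ideal R I m d J\<^sub>0)"

definition nil_hecke_gen ::
  "('k, 'q) ring_scheme \<Rightarrow> 'i set \<Rightarrow> ('i \<Rightarrow> 'i \<Rightarrow> enat) \<Rightarrow> ('i \<Rightarrow> nat) \<Rightarrow> 'i set set
     \<Rightarrow> 'i \<Rightarrow> ('i list \<Rightarrow> 'k) set" where
  "nil_hecke_gen R I m d J\<^sub>0 i = nil_hecke_ideal R I m d J\<^sub>0 +>\<^bsub>free_algebra R I\<^esub> free_word R [i]"

definition nil_hecke_monomial ::
  "('k, 'q) ring_scheme \<Rightarrow> 'i set \<Rightarrow> ('i \<Rightarrow> 'i \<Rightarrow> enat) \<Rightarrow> ('i \<Rightarrow> nat) \<Rightarrow> 'i set set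
     \<Rightarrow> 'i list \<Rightarrow> ('i list \<Rightarrow> 'k) set" where
  "nil_hecke_monomial R I m d J\<^sub>0 w =
     foldr (\<lambda>i x. nil_hecke_gen R I m d J\<^sub>0 i \<otimes>\<^bsub>nil_hecke R I m d J\<^sub>0\<^esub> x) w \<one>\<^bsub>nil_hecke R I m d J\<^sub>0\<^esub>"


section \<open>Free module bases\<close>

text \<open>
  The basis is an indexed family \<open>(b x)\<^sub>x\<^sub>\<in>\<^sub>S\<close>, so independence also rules out repetitions
  \<open>b x = b y\<close> with \<open>x \<noteq> y\<close> (unless \<open>R\<close> is the zero ring).
\<close>

definition free_basis ::
  "('k, 'q) ring_scheme \<Rightarrow> ('k, 'a, 'r) module_scheme \<Rightarrow> 's set \<Rightarrow> ('s \<Rightarrow> 'a) \<Rightarrow> bool" where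
  "free_basis R M S b \<longleftrightarrow>
     (\<forall>x\<in>S. b x \<in> carrier M) \<and>
     (\<forall>F c. finite F \<and> F \<subseteq> S \<and> c \<in> F \<rightarrow> carrier R
        \<and> (\<Oplus>\<^bsub>M\<^esub>x\<in>F. c x \<odot>\<^bsub>M\<^esub> b x) = \<zero>\<^bsub>M\<^esub> \<longrightarrow> (\<forall>x\<in>F. c x = \<zero>\<^bsub>R\<^esub>)) \<and>
     (\<forall>y\<in>carrier M. \<exists>F c. finite F \<and> F \<subseteq> S \<and> c \<in> F \<rightarrow> carrier R
        \<and> y = (\<Oplus>\<^bsub>M\<^esub>x\<in>F. c x \<odot>\<^bsub>M\<^esub> b x))"

end

theory Submission
  imports Defs
begin

text \<open>
  The nil-Hecke algebra is a contracted monoid algebra: each of its relations equates two words or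
  kills a word. Its basis should therefore consist of the classes of words, under the relations
  that equate words, that contain no word killed by a relation. There are two points to settle: that
  the full braid equivalence may replace the equivalence generated by the short braid relations
  alone, and that the ideal of relations does not collapse these classes further.
  
  The first point is settled by the remark that every braid move, short or long, preserves the coset
  of a word modulo the ideal: if the braid words are shorter than \<open>k\<close>, their difference is a
  relator, and otherwise both of them lie in the ideal (\<open>braid_move_coset_eq\<close>). So equivalent
  words have equal cosets, a word equivalent to one containing a forbidden substring has zero coset,
  and every element of the algebra is congruent to a combination of representatives of the
  admissible classes (\<open>normal_form_exists\<close>). This is spanning.
  
  For independence, linear functionals vanishing on the ideal are needed. The sum of the
  coefficients of an element over an admissible class is one. To prove that it vanishes on the ideal
  without rewriting theory, consider all finite sets \<open>D\<close> of words that are closed under braid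
  moves and free of forbidden substrings (\<open>braid_stable\<close>), and let \<open>stable_sum_kernel\<close> be
  the set of all elements whose coefficients sum to zero over each such \<open>D\<close>. Multiplying an
  element by a word \<open>u\<close> on the left turns its sum over \<open>D\<close> into a sum over
  \<open>{v. u @ v \<in> D}\<close>, and this set is again closed and free of forbidden substrings; the right
  side is symmetric. Hence \<open>stable_sum_kernel\<close> is a two-sided ideal
  (\<open>stable_sum_kernel_ideal\<close>). It contains the relators, because \<open>D\<close> contains neither
  side of a long braid relation and both or neither side of a short one. An admissible class is such
  a set \<open>D\<close>, finite because braid moves preserve length, and it meets the set of representatives
  in exactly one word. Summing a vanishing combination of representatives over the class therefore
  isolates one coefficient and shows that it is zero.
\<close>


section \<open>The free algebra as a ring\<close>

text \<open>
  The product of the free algebra refers neither to the alphabet nor to finite supports. As a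
  function on all coefficient families it admits a recursion over words that uses the shifted family
  \<open>\<lambda>v. f (a # v)\<close>, which replaces the manipulation of double sums below.
\<close>
definition convolution ::
  "('k, 'q) ring_scheme \<Rightarrow> ('i list \<Rightarrow> 'k) \<Rightarrow> ('i list \<Rightarrow> 'k) \<Rightarrow> 'i list \<Rightarrow> 'k" where
  "convolution R f g w = (\<Oplus>\<^bsub>R\<^esub>n\<in>{..length w}. f (take n w) \<otimes>\<^bsub>R\<^esub> g (drop n w))"

definition monomial :: "('k, 'q) ring_scheme \<Rightarrow> 'k \<Rightarrow> 'i list \<Rightarrow> 'i list \<Rightarrow> 'k" where
  "monomial R c u = (\<lambda>w. if w = u then c else \<zero>\<^bsub>R\<^esub>)"

lemma free_algebra_simps:
  "carrier (free_algebra R I) =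
     {f. (\<forall>w. f w \<in> carrier R) \<and> finite {w. f w \<noteq> \<zero>\<^bsub>R\<^esub>} \<and> {w. f w \<noteq> \<zero>\<^bsub>R\<^esub>} \<subseteq> lists I}"
  "f \<otimes>\<^bsub>free_algebra R I\<^esub> g = convolution R f g"
  "\<one>\<^bsub>free_algebra R I\<^esub> = monomial R \<one>\<^bsub>R\<^esub> []"
  "\<zero>\<^bsub>free_algebra R I\<^esub> = (\<lambda>w. \<zero>\<^bsub>R\<^esub>)"
  "f \<oplus>\<^bsub>free_algebra R I\<^esub> g = (\<lambda>w. f w \<oplus>\<^bsub>R\<^esub> g w)"
  "c \<odot>\<^bsub>free_algebra R I\<^esub> f = (\<lambda>w. c \<otimes>\<^bsub>R\<^esub> f w)"
  by (auto simp: free_algebra_def convolution_def monomial_def fun_eq_iff)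

lemma free_word_eq_monomial: "free_word R u = monomial R \<one>\<^bsub>R\<^esub> u"
  by (simp add: free_word_def monomial_def)

context cring
begin

lemma convolution_closed:
  assumes "\<And>w. f w \<in> carrier R" and "\<And>w. g w \<in> carrier R"
  shows "convolution R f g w \<in> carrier R"
  using assms by (auto simp: convolution_def intro!: finsum_closed)

lemma convolution_Nil:
  assumes "f [] \<in> carrier R" and "g [] \<in> carrier R"
  shows "convolution R f g [] = f [] \<otimes> g []"
  using assms by (simp add: convolution_def)

text \<open>
  The empty prefix of \<open>a # w\<close> contributes the first summand; all other prefixes begin with
  \<open>a\<close>.
\<close>
lemma convolution_Cons:
  assumes "\<And>w. f w \<in> carrier R" and "\<And>w. g w \<in> carrier R"
  shows "convolution R f g (a # w) = f [] \<otimes> g (a # w) \<oplus> convolution R (\<lambda>v. f (a # v)) g w"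
proof -
  have "convolution R f g (a # w)
      = (\<Oplus>n\<in>{..length w}. f (a # take n w) \<otimes> g (drop n w)) \<oplus> f [] \<otimes> g (a # w)"
    unfolding convolution_def using assms by (simp add: finsum_Suc2 Pi_def del: finsum_Suc)
  then show ?thesis
    using assms by (simp add: convolution_def a_comm finsum_closed)
qed

text \<open>
  The scalar \<open>c\<close> is needed in the associativity proof, where the shift of a convolution is of
  the form \<open>c \<otimes> f v \<oplus> g v\<close>.
\<close>
lemma convolution_lincomb_left:
  assumes "\<And>w. f w \<in> carrier R" "\<And>w. g w \<in> carrier R" "\<And>w. h w \<in> carrier R" "c \<in> carrier R"
  shows "convolution R (\<lambda>v. c \<otimes> f v \<oplus> g v) h w
    = c \<otimes> convolution R f h w \<oplus> convolution R g h w"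
  using assms(1,2)
proof (induction w arbitrary: f g)
  case Nil
  then show ?case using assms(3,4) by (simp add: convolution_Nil l_distr m_assoc)
next
  case (Cons a w)
  note [simp] = assms(3,4) Cons.prems
  have "convolution R f' h w \<in> carrier R" if "\<And>w. f' w \<in> carrier R" for f'
    using that by (intro convolution_closed) auto
  note [simp] = this
  have "convolution R (\<lambda>v. c \<otimes> f v \<oplus> g v) h (a # w)
    = (c \<otimes> f [] \<oplus> g []) \<otimes> h (a # w) \<oplus>
      (c \<otimes> convolution R (\<lambda>v. f (a # v)) h w \<oplus> convolution R (\<lambda>v. g (a # v)) h w)"
    by (subst convolution_Cons) (auto simp: Cons.IH)
  also have "\<dots> = c \<otimes> convolution R f h (a # w) \<oplus> convolution R g h (a # w)"
    by (simp add: convolution_Cons l_distr r_distr m_assoc a_ac)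
  finally show ?case .
qed

lemma convolution_add_left:
  assumes "\<And>w. f w \<in> carrier R" "\<And>w. g w \<in> carrier R" "\<And>w. h w \<in> carrier R"
  shows "convolution R (\<lambda>v. f v \<oplus> g v) h w = convolution R f h w \<oplus> convolution R g h w"
  using convolution_lincomb_left[OF assms, of "\<one>"] assms
  by (simp add: convolution_closed)

lemma convolution_add_right:
  assumes "\<And>w. f w \<in> carrier R" "\<And>w. g w \<in> carrier R" "\<And>w. h w \<in> carrier R"
  shows "convolution R h (\<lambda>v. f v \<oplus> g v) w = convolution R h f w \<oplus> convolution R h g w"
  using assms by (simp add: convolution_def r_distr finsum_addf Pi_def)

lemma convolution_assoc:
  assumes "\<And>w. f w \<in> carrier R" "\<And>w. g w \<in> carrier R" "\<And>w. h w \<in> carrier R"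
  shows "convolution R (convolution R f g) h w = convolution R f (convolution R g h) w"
  using assms(1)
proof (induction w arbitrary: f)
  case Nil
  then show ?case using assms(2,3) by (simp add: convolution_Nil convolution_closed m_assoc)
next
  case (Cons a w)
  note [simp] = assms(2,3) Cons.prems
  have [simp]: "convolution R f' g' w \<in> carrier R"
    if "\<And>w. f' w \<in> carrier R" "\<And>w. g' w \<in> carrier R" for f' g' w
    using that by (rule convolution_closed)
  have "convolution R (convolution R f g) h (a # w)
      = (f [] \<otimes> g []) \<otimes> h (a # w) \<oplus>
        convolution R (\<lambda>v. f [] \<otimes> g (a # v) \<oplus> convolution R (\<lambda>v. f (a # v)) g v) h w"
    by (simp add: convolution_Cons convolution_Nil)
  also have "\<dots> = (f [] \<otimes> g []) \<otimes> h (a # w) \<oplus>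
        (f [] \<otimes> convolution R (\<lambda>v. g (a # v)) h w
          \<oplus> convolution R (\<lambda>v. f (a # v)) (convolution R g h) w)"
    by (simp add: convolution_lincomb_left Cons.IH)
  also have "\<dots> = f [] \<otimes> (g [] \<otimes> h (a # w) \<oplus> convolution R (\<lambda>v. g (a # v)) h w)
      \<oplus> convolution R (\<lambda>v. f (a # v)) (convolution R g h) w"
    by (simp add: r_distr m_assoc a_assoc)
  also have "\<dots> = convolution R f (convolution R g h) (a # w)"
    by (simp add: convolution_Cons)
  finally show ?case .
qed

lemma monomial_closed: "c \<in> carrier R \<Longrightarrow> monomial R c u w \<in> carrier R"
  by (simp add: monomial_def)

lemma convolution_zero_left:
  "(\<And>w. g w \<in> carrier R) \<Longrightarrow> convolution R (\<lambda>v. \<zero>) g w = \<zero>"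
  by (simp add: convolution_def)

lemma convolution_monomial_left:
  assumes "c \<in> carrier R" and "\<And>w. g w \<in> carrier R"
  shows "convolution R (monomial R c u) g w = (if prefix u w then c \<otimes> g (drop (length u) w) else \<zero>)"
proof (induction w arbitrary: u)
  case Nil
  then show ?case using assms by (auto simp: convolution_Nil monomial_def)
next
  case (Cons a w)
  show ?case
  proof (cases u)
    case Nil
    have "(\<lambda>v. monomial R c u (a # v)) = (\<lambda>v. \<zero>)"
      using Nil by (auto simp: monomial_def)
    then show ?thesis using Nil assms
      by (simp add: convolution_Cons monomial_closed convolution_zero_left)
         (simp add: monomial_def)
  next
    case (Cons b u')
    have "(\<lambda>v. monomial R c u (a # v)) = (if a = b then monomial R c u' else (\<lambda>v. \<zero>))"
      using Cons by (auto simp: monomial_def)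
    moreover have "monomial R c u [] = \<zero>" using Cons by (simp add: monomial_def)
    ultimately show ?thesis
      using Cons assms Cons.IH[of u'] convolution_closed[of "monomial R c u'" g w]
      by (simp add: convolution_Cons monomial_closed convolution_zero_left)
  qed
qed

lemma convolution_monomial_right:
  assumes "c \<in> carrier R" and "\<And>w. f w \<in> carrier R"
  shows "convolution R f (monomial R c u) w
    = (if suffix u w then f (take (length w - length u) w) \<otimes> c else \<zero>)"
  using assms(2)
proof (induction w arbitrary: f)
  case Nil
  then show ?case using assms(1) by (auto simp: convolution_Nil monomial_def)
next
  case (Cons a w)
  show ?case
  proof (cases "a # w = u")
    case True
    then have "\<not> suffix u w" by (auto dest: suffix_length_le)
    moreover have "monomial R c u (a # w) = c" using True by (simp add: monomial_def)
    ultimately show ?thesis using True Cons assms(1)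
      by (auto simp: convolution_Cons monomial_closed)
  next
    case False
    have "length u \<le> length w" if "suffix u w" using that by (rule suffix_length_le)
    then have "f (take (length (a # w) - length u) (a # w)) = f (a # take (length w - length u) w)"
      if "suffix u w"
      using that by (simp add: Suc_diff_le)
    moreover have "suffix u (a # w) \<longleftrightarrow> suffix u w" using False by (auto simp: suffix_Cons)
    ultimately show ?thesis using False Cons assms(1)
      by (simp add: convolution_Cons monomial_closed) (simp add: monomial_def)
  qed
qed

lemma convolution_support:
  assumes "\<And>w. f w \<in> carrier R" and "\<And>w. g w \<in> carrier R"
  shows "{w. convolution R f g w \<noteq> \<zero>} \<subseteq> (\<lambda>(u, v). u @ v) ` ({u. f u \<noteq> \<zero>} \<times> {v. g v \<noteq> \<zero>})"
proof
  fix w assume w: "w \<in> {w. convolution R f g w \<noteq> \<zero>}"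
  have "\<exists>n. f (take n w) \<otimes> g (drop n w) \<noteq> \<zero>"
  proof (rule ccontr)
    assume "\<not> ?thesis"
    then have "convolution R f g w = \<zero>" by (simp add: convolution_def)
    then show False using w by simp
  qed
  then obtain n where n: "f (take n w) \<otimes> g (drop n w) \<noteq> \<zero>" ..
  then have "f (take n w) \<noteq> \<zero>" "g (drop n w) \<noteq> \<zero>" using assms by auto
  then show "w \<in> (\<lambda>(u, v). u @ v) ` ({u. f u \<noteq> \<zero>} \<times> {v. g v \<noteq> \<zero>})"
    by (intro image_eqI[of _ _ "(take n w, drop n w)"]) auto
qed

lemma free_algebra_ring:
  fixes I :: "'i set"
  shows "ring (free_algebra R I)"
proof (rule ringI)
  show "abelian_group (free_algebra R I)"
  proof (rule abelian_groupI; simp only: free_algebra_simps mem_Collect_eq)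
    fix f g :: "'i list \<Rightarrow> 'a"
    assume f: "(\<forall>w. f w \<in> carrier R) \<and> finite {w. f w \<noteq> \<zero>} \<and> {w. f w \<noteq> \<zero>} \<subseteq> lists I"
      and g: "(\<forall>w. g w \<in> carrier R) \<and> finite {w. g w \<noteq> \<zero>} \<and> {w. g w \<noteq> \<zero>} \<subseteq> lists I"
    have "{w. f w \<oplus> g w \<noteq> \<zero>} \<subseteq> {w. f w \<noteq> \<zero>} \<union> {w. g w \<noteq> \<zero>}" using f g by auto
    moreover have "finite ({w. f w \<noteq> \<zero>} \<union> {w. g w \<noteq> \<zero>})" using f g by simp
    ultimately show "(\<forall>w. f w \<oplus> g w \<in> carrier R) \<and> finite {w. f w \<oplus> g w \<noteq> \<zero>}
        \<and> {w. f w \<oplus> g w \<noteq> \<zero>} \<subseteq> lists I"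
      using f g by (blast intro: finite_subset)
  next
    fix f :: "'i list \<Rightarrow> 'a"
    assume f: "(\<forall>w. f w \<in> carrier R) \<and> finite {w. f w \<noteq> \<zero>} \<and> {w. f w \<noteq> \<zero>} \<subseteq> lists I"
    have "{w. \<ominus> f w \<noteq> \<zero>} = {w. f w \<noteq> \<zero>}" using f by auto
    then show "\<exists>y\<in>{g. (\<forall>w. g w \<in> carrier R) \<and> finite {w. g w \<noteq> \<zero>} \<and> {w. g w \<noteq> \<zero>} \<subseteq> lists I}.
        (\<lambda>w. y w \<oplus> f w) = (\<lambda>w. \<zero>)"
      using f by (intro bexI[of _ "\<lambda>w. \<ominus> f w"]) (auto simp: l_neg)
  qed (auto simp: fun_eq_iff a_assoc intro: a_comm)
  show "monoid (free_algebra R I)"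
  proof (rule monoidI; simp only: free_algebra_simps mem_Collect_eq)
    fix f g :: "'i list \<Rightarrow> 'a"
    assume f: "(\<forall>w. f w \<in> carrier R) \<and> finite {w. f w \<noteq> \<zero>} \<and> {w. f w \<noteq> \<zero>} \<subseteq> lists I"
      and g: "(\<forall>w. g w \<in> carrier R) \<and> finite {w. g w \<noteq> \<zero>} \<and> {w. g w \<noteq> \<zero>} \<subseteq> lists I"
    let ?S = "(\<lambda>(u, v). u @ v) ` ({u. f u \<noteq> \<zero>} \<times> {v. g v \<noteq> \<zero>})"
    have "{w. convolution R f g w \<noteq> \<zero>} \<subseteq> ?S" using f g by (intro convolution_support) auto
    moreover have "finite ?S" using f g by simp
    moreover have "?S \<subseteq> lists I" using f g by (auto 4 4)
    ultimately show "(\<forall>w. convolution R f g w \<in> carrier R) \<and> finite {w. convolution R f g w \<noteq> \<zero>}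
        \<and> {w. convolution R f g w \<noteq> \<zero>} \<subseteq> lists I"
      using f g by (auto intro: convolution_closed finite_subset)
  next
    show "(\<forall>w::'i list. monomial R \<one> [] w \<in> carrier R) \<and> finite {w::'i list. monomial R \<one> [] w \<noteq> \<zero>}
        \<and> {w. monomial R \<one> [] w \<noteq> \<zero>} \<subseteq> lists I"
      by (auto simp: monomial_def)
  qed (auto simp: fun_eq_iff convolution_assoc convolution_monomial_left convolution_monomial_right)
qed (auto simp: free_algebra_simps fun_eq_iff convolution_add_left convolution_add_right)


lemma free_algebra_valued: "f \<in> carrier (free_algebra R I) \<Longrightarrow> f w \<in> carrier R"
  by (simp add: free_algebra_simps)

lemma monomial_in_free_algebra:
  "c \<in> carrier R \<Longrightarrow> u \<in> lists I \<Longrightarrow> monomial R c u \<in> carrier (free_algebra R I)"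
  by (auto simp: free_algebra_simps monomial_def)

lemma free_word_in_free_algebra: "u \<in> lists I \<Longrightarrow> free_word R u \<in> carrier (free_algebra R I)"
  by (simp add: free_word_eq_monomial monomial_in_free_algebra)

lemma free_word_append:
  "free_word R u \<otimes>\<^bsub>free_algebra R I\<^esub> free_word R v = free_word R (u @ v)"
  by (auto simp: free_algebra_simps free_word_eq_monomial fun_eq_iff convolution_monomial_left
      monomial_closed) (auto simp: monomial_def prefix_def)

lemma smult_free_word:
  "c \<in> carrier R \<Longrightarrow> c \<odot>\<^bsub>free_algebra R I\<^esub> free_word R u = monomial R c u"
  by (auto simp: free_algebra_simps free_word_def monomial_def)

lemma smult_eq_mult:
  assumes "c \<in> carrier R" and "f \<in> carrier (free_algebra R I)"
  shows "c \<odot>\<^bsub>free_algebra R I\<^esub> f = monomial R c [] \<otimes>\<^bsub>free_algebra R I\<^esub> f"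
  using assms
  by (simp add: free_algebra_simps fun_eq_iff convolution_monomial_left)

lemma free_algebra_smult_closed:
  assumes "c \<in> carrier R" and "f \<in> carrier (free_algebra R I)"
  shows "c \<odot>\<^bsub>free_algebra R I\<^esub> f \<in> carrier (free_algebra R I)"
proof -
  interpret A: ring "free_algebra R I" by (rule free_algebra_ring)
  show ?thesis using assms by (simp add: smult_eq_mult monomial_in_free_algebra)
qed

text \<open>
  An element of the free algebra is built up from zero by adding one monomial at a time, since its
  support is finite. By this rule, multiplicative statements need only be proved for monomials.
\<close>
lemma free_algebra_induct [consumes 1, case_names zero add_monomial]:
  fixes I :: "'i set"
  assumes f: "f \<in> carrier (free_algebra R I)"
    and zero: "P (\<lambda>w. \<zero>)"
    and step: "\<And>f c u. f \<in> carrier (free_algebra R I) \<Longrightarrow> P f \<Longrightarrow> c \<in> carrier R \<Longrightarrow> u \<in> lists I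
      \<Longrightarrow> P (monomial R c u \<oplus>\<^bsub>free_algebra R I\<^esub> f)"
  shows "P f"
proof -
  have "finite {w. f w \<noteq> \<zero>}" using f by (simp add: free_algebra_simps)
  then show ?thesis using f
  proof (induction "{w. f w \<noteq> \<zero>}" arbitrary: f rule: finite_psubset_induct)
    case (psubset f)
    show ?case
    proof (cases "\<exists>u. f u \<noteq> \<zero>")
      case False
      then have "f = (\<lambda>w. \<zero>)" by auto
      then show ?thesis using zero by simp
    next
      case True
      then obtain u where u: "f u \<noteq> \<zero>" by blast
      define g where "g = f(u := \<zero>)"
      have supp: "{w. g w \<noteq> \<zero>} = {w. f w \<noteq> \<zero>} - {u}" by (auto simp: g_def)
      have vals: "g w \<in> carrier R" for w
        using free_algebra_valued[OF psubset.prems] by (simp add: g_def)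
      have g: "g \<in> carrier (free_algebra R I)"
        using psubset.prems vals supp by (auto simp: free_algebra_simps)
      have uI: "u \<in> lists I" using psubset.prems u by (auto simp: free_algebra_simps)
      have "P g" using psubset.hyps(2)[of g] supp u g by auto
      then have "P (monomial R (f u) u \<oplus>\<^bsub>free_algebra R I\<^esub> g)"
        using step g uI free_algebra_valued[OF psubset.prems] by blast
      also have "monomial R (f u) u \<oplus>\<^bsub>free_algebra R I\<^esub> g = f"
        using free_algebra_valued[OF psubset.prems]
        by (auto simp: free_algebra_simps monomial_def g_def)
      finally show ?thesis .
    qed
  qed
qed


section \<open>Quotients of the free algebra\<close>

lemma quotient_algebra_simps:
  "carrier (quotient_algebra A K) = a_rcosets\<^bsub>A\<^esub> K"
  "x \<otimes>\<^bsub>quotient_algebra A K\<^esub> y = rcoset_mult A K x y"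
  "\<one>\<^bsub>quotient_algebra A K\<^esub> = K +>\<^bsub>A\<^esub> \<one>\<^bsub>A\<^esub>"
  "\<zero>\<^bsub>quotient_algebra A K\<^esub> = K"
  "x \<oplus>\<^bsub>quotient_algebra A K\<^esub> y = x <+>\<^bsub>A\<^esub> y"
  "c \<odot>\<^bsub>quotient_algebra A K\<^esub> X = (\<Union>x\<in>X. K +>\<^bsub>A\<^esub> (c \<odot>\<^bsub>A\<^esub> x))"
  unfolding quotient_algebra_def FactRing_def ring.extend_def module.fields_def by simp_all

lemma quotient_algebra_carrier:
  "carrier (quotient_algebra A K) = (\<lambda>f. K +>\<^bsub>A\<^esub> f) ` carrier A"
  by (auto simp: quotient_algebra_simps A_RCOSETS_def')

text \<open>
  Cosets of an ideal of the free algebra are closed under scalar multiplication because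
  \<open>c \<odot> f\<close> equals the product of \<open>f\<close> with the constant \<open>c\<close>. Thus passing to
  cosets is linear, and linear combinations can be computed before taking the quotient.
\<close>
context
  fixes I :: "'i set" and K :: "('i list \<Rightarrow> 'a) set"
  assumes K: "ideal K (free_algebra R I)"
begin

interpretation K: ideal K "free_algebra R I" by (rule K)

lemma coset_eq_iff_diff_mem:
  assumes "f \<in> carrier (free_algebra R I)" and "g \<in> carrier (free_algebra R I)"
  shows "K +>\<^bsub>free_algebra R I\<^esub> f = K +>\<^bsub>free_algebra R I\<^esub> g \<longleftrightarrow> f \<ominus>\<^bsub>free_algebra R I\<^esub> g \<in> K"
proof
  assume "K +>\<^bsub>free_algebra R I\<^esub> f = K +>\<^bsub>free_algebra R I\<^esub> g"
  then have "f \<in> K +>\<^bsub>free_algebra R I\<^esub> g" using K.a_rcos_self[OF assms(1)] by simp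
  then show "f \<ominus>\<^bsub>free_algebra R I\<^esub> g \<in> K"
    using K.a_rcos_module_minus[OF free_algebra_ring assms(2,1)] by simp
next
  assume "f \<ominus>\<^bsub>free_algebra R I\<^esub> g \<in> K"
  then have "f \<in> K +>\<^bsub>free_algebra R I\<^esub> g"
    using K.a_rcos_module_minus[OF free_algebra_ring assms(2,1)] by simp
  then show "K +>\<^bsub>free_algebra R I\<^esub> f = K +>\<^bsub>free_algebra R I\<^esub> g"
    using K.a_repr_independence'[OF _ assms(2)] by simp
qed

lemma coset_eq_ideal_iff:
  assumes "f \<in> carrier (free_algebra R I)"
  shows "K +>\<^bsub>free_algebra R I\<^esub> f = K \<longleftrightarrow> f \<in> K"
  using K.a_rcos_const[of f] K.a_rcos_self[OF assms] by auto

lemma coset_zero: "K +>\<^bsub>free_algebra R I\<^esub> \<zero>\<^bsub>free_algebra R I\<^esub> = K"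
  by (rule K.a_rcos_const) (rule additive_subgroup.zero_closed[OF K.is_additive_subgroup])

lemma quotient_algebra_abelian_monoid: "abelian_monoid (quotient_algebra (free_algebra R I) K)"
proof (rule abelian_monoidI)
  show "\<zero>\<^bsub>quotient_algebra (free_algebra R I) K\<^esub> \<in> carrier (quotient_algebra (free_algebra R I) K)"
    using coset_zero by (auto simp: quotient_algebra_carrier quotient_algebra_simps(4) image_iff)
next
  fix x assume "x \<in> carrier (quotient_algebra (free_algebra R I) K)"
  then obtain f where f: "f \<in> carrier (free_algebra R I)" "x = K +>\<^bsub>free_algebra R I\<^esub> f"
    by (auto simp: quotient_algebra_carrier)
  show "\<zero>\<^bsub>quotient_algebra (free_algebra R I) K\<^esub> \<oplus>\<^bsub>quotient_algebra (free_algebra R I) K\<^esub> x = x"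
    using K.a_rcos_sum[OF K.zero_closed f(1)] f coset_zero by (simp add: quotient_algebra_simps)
next
  fix x y assume "x \<in> carrier (quotient_algebra (free_algebra R I) K)"
    "y \<in> carrier (quotient_algebra (free_algebra R I) K)"
  then obtain f g where "f \<in> carrier (free_algebra R I)" "x = K +>\<^bsub>free_algebra R I\<^esub> f"
    "g \<in> carrier (free_algebra R I)" "y = K +>\<^bsub>free_algebra R I\<^esub> g"
    by (auto simp: quotient_algebra_carrier)
  then show "x \<oplus>\<^bsub>quotient_algebra (free_algebra R I) K\<^esub> y
      = y \<oplus>\<^bsub>quotient_algebra (free_algebra R I) K\<^esub> x"
    using K.a_comm by (simp add: quotient_algebra_simps(5) K.a_rcos_sum)
qed (auto simp: quotient_algebra_carrier quotient_algebra_simps(5) K.a_rcos_sum K.a_assoc)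

lemma quotient_algebra_add:
  assumes "f \<in> carrier (free_algebra R I)" and "g \<in> carrier (free_algebra R I)"
  shows "(K +>\<^bsub>free_algebra R I\<^esub> f) \<oplus>\<^bsub>quotient_algebra (free_algebra R I) K\<^esub> (K +>\<^bsub>free_algebra R I\<^esub> g)
    = K +>\<^bsub>free_algebra R I\<^esub> (f \<oplus>\<^bsub>free_algebra R I\<^esub> g)"
  using assms by (simp add: quotient_algebra_simps K.a_rcos_sum)

lemma quotient_algebra_smult:
  assumes c: "c \<in> carrier R" and f: "f \<in> carrier (free_algebra R I)"
  shows "c \<odot>\<^bsub>quotient_algebra (free_algebra R I) K\<^esub> (K +>\<^bsub>free_algebra R I\<^esub> f)
    = K +>\<^bsub>free_algebra R I\<^esub> (c \<odot>\<^bsub>free_algebra R I\<^esub> f)"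
proof -
  have cc: "monomial R c [] \<in> carrier (free_algebra R I)"
    using c by (simp add: monomial_in_free_algebra)
  have "K +>\<^bsub>free_algebra R I\<^esub> (c \<odot>\<^bsub>free_algebra R I\<^esub> x) = K +>\<^bsub>free_algebra R I\<^esub> (c \<odot>\<^bsub>free_algebra R I\<^esub> f)"
    if x: "x \<in> K +>\<^bsub>free_algebra R I\<^esub> f" for x
  proof -
    have xc: "x \<in> carrier (free_algebra R I)" using K.a_elemrcos_carrier[OF f x] .
    have "x \<ominus>\<^bsub>free_algebra R I\<^esub> f \<in> K"
      using x K.a_repr_independence'[OF x f] coset_eq_iff_diff_mem[OF xc f] by simp
    then have "monomial R c [] \<otimes>\<^bsub>free_algebra R I\<^esub> (x \<ominus>\<^bsub>free_algebra R I\<^esub> f) \<in> K"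
      using cc by (rule K.I_l_closed)
    then have "c \<odot>\<^bsub>free_algebra R I\<^esub> x \<ominus>\<^bsub>free_algebra R I\<^esub> c \<odot>\<^bsub>free_algebra R I\<^esub> f \<in> K"
      using xc f cc c by (simp add: smult_eq_mult K.minus_eq K.r_distr K.r_minus)
    then show ?thesis
      using xc f c by (subst coset_eq_iff_diff_mem) (simp_all add: free_algebra_smult_closed)
  qed
  moreover have "f \<in> K +>\<^bsub>free_algebra R I\<^esub> f" using f by (rule K.a_rcos_self)
  ultimately show ?thesis unfolding quotient_algebra_simps(6) by blast
qed

lemma quotient_algebra_lincomb:
  assumes "finite F" and "c \<in> F \<rightarrow> carrier R" and "f \<in> F \<rightarrow> carrier (free_algebra R I)"
  shows "(\<Oplus>\<^bsub>quotient_algebra (free_algebra R I) K\<^esub>x\<in>F.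
      c x \<odot>\<^bsub>quotient_algebra (free_algebra R I) K\<^esub> (K +>\<^bsub>free_algebra R I\<^esub> f x))
    = K +>\<^bsub>free_algebra R I\<^esub> (\<Oplus>\<^bsub>free_algebra R I\<^esub>x\<in>F. c x \<odot>\<^bsub>free_algebra R I\<^esub> f x)"
  using assms
proof (induction F)
  case empty
  interpret Q: abelian_monoid "quotient_algebra (free_algebra R I) K"
    by (rule quotient_algebra_abelian_monoid)
  show ?case using coset_zero by (simp add: quotient_algebra_simps(4))
next
  case (insert x F)
  interpret Q: abelian_monoid "quotient_algebra (free_algebra R I) K"
    by (rule quotient_algebra_abelian_monoid)
  have cf: "c y \<in> carrier R" "f y \<in> carrier (free_algebra R I)" if "y \<in> insert x F" for y
    using insert.prems that by blast+
  then have cl: "c y \<odot>\<^bsub>free_algebra R I\<^esub> f y \<in> carrier (free_algebra R I)"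
    if "y \<in> insert x F" for y
    using that by (simp add: free_algebra_smult_closed)
  then have sm: "c y \<odot>\<^bsub>quotient_algebra (free_algebra R I) K\<^esub> (K +>\<^bsub>free_algebra R I\<^esub> f y)
      \<in> carrier (quotient_algebra (free_algebra R I) K)" if "y \<in> insert x F" for y
    using cf that by (simp add: quotient_algebra_carrier quotient_algebra_smult)
  have "(\<Oplus>\<^bsub>free_algebra R I\<^esub>x\<in>F. c x \<odot>\<^bsub>free_algebra R I\<^esub> f x) \<in> carrier (free_algebra R I)"
    using cl by (intro K.finsum_closed) auto
  then have "(K +>\<^bsub>free_algebra R I\<^esub> (c x \<odot>\<^bsub>free_algebra R I\<^esub> f x))
      \<oplus>\<^bsub>quotient_algebra (free_algebra R I) K\<^esub>
        (K +>\<^bsub>free_algebra R I\<^esub> (\<Oplus>\<^bsub>free_algebra R I\<^esub>x\<in>F. c x \<odot>\<^bsub>free_algebra R I\<^esub> f x))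
      = K +>\<^bsub>free_algebra R I\<^esub> (\<Oplus>\<^bsub>free_algebra R I\<^esub>x\<in>insert x F. c x \<odot>\<^bsub>free_algebra R I\<^esub> f x)"
    using cl insert.hyps by (subst K.finsum_insert) (auto simp: quotient_algebra_add)
  moreover have "(\<Oplus>\<^bsub>quotient_algebra (free_algebra R I) K\<^esub>y\<in>insert x F.
      c y \<odot>\<^bsub>quotient_algebra (free_algebra R I) K\<^esub> (K +>\<^bsub>free_algebra R I\<^esub> f y))
      = (c x \<odot>\<^bsub>quotient_algebra (free_algebra R I) K\<^esub> (K +>\<^bsub>free_algebra R I\<^esub> f x))
        \<oplus>\<^bsub>quotient_algebra (free_algebra R I) K\<^esub>
        (\<Oplus>\<^bsub>quotient_algebra (free_algebra R I) K\<^esub>y\<in>F.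
          c y \<odot>\<^bsub>quotient_algebra (free_algebra R I) K\<^esub> (K +>\<^bsub>free_algebra R I\<^esub> f y))"
    using sm insert.hyps by (intro Q.finsum_insert) auto
  moreover have "c \<in> F \<rightarrow> carrier R" "f \<in> F \<rightarrow> carrier (free_algebra R I)"
    using insert.prems by auto
  ultimately show ?case
    using insert.IH cf[of x] by (simp only: quotient_algebra_smult insertI1)
qed

end

end

section \<open>Braid moves and vanishing words\<close>

text \<open>
  The forbidden substrings are the words that the nil-Hecke relations send to zero: the powers
  \<open>s\<^sub>i\<close> to the \<open>d i\<close> and the braid words of length at least \<open>k\<close>.
\<close>
definition nonvanishing_word ::
  "'i set \<Rightarrow> ('i \<Rightarrow> 'i \<Rightarrow> enat) \<Rightarrow> ('i \<Rightarrow> nat) \<Rightarrow> enat \<Rightarrow> 'i list \<Rightarrow> bool" where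
  "nonvanishing_word I m d k w \<longleftrightarrow>
     (\<forall>i\<in>I. \<not> sublist (replicate (d i) i) w) \<and>
     (\<forall>a b. {a, b} \<in> finite_pairs I m \<and> k \<le> enat (length (braid_word m a b))
        \<longrightarrow> \<not> sublist (braid_word m a b) w)"

text \<open>
  Closure is required under all braid moves. Since no word of \<open>D\<close> contains a braid word of
  length at least \<open>k\<close>, only moves along short braid relations can in fact occur in \<open>D\<close>.
\<close>
definition braid_stable ::
  "'i set \<Rightarrow> ('i \<Rightarrow> 'i \<Rightarrow> enat) \<Rightarrow> ('i \<Rightarrow> nat) \<Rightarrow> enat \<Rightarrow> 'i list set \<Rightarrow> bool" where
  "braid_stable I m d k D \<longleftrightarrow> finite D \<and> D \<subseteq> lists I \<and>
     (\<forall>w w'. (w, w') \<in> braid_move I m \<longrightarrow> w \<in> D \<longrightarrow> w' \<in> D) \<and>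
     (\<forall>w\<in>D. nonvanishing_word I m d k w)"

lemma length_alternating_word [simp]: "length (alternating_word n a b) = n"
  by (induction n a b rule: alternating_word.induct) auto

lemma alternating_word_in_lists: "a \<in> I \<Longrightarrow> b \<in> I \<Longrightarrow> alternating_word n a b \<in> lists I"
  by (induction n a b rule: alternating_word.induct) auto

lemma finite_pairs_memD:
  assumes "coxeter_matrix I m" and "{a, b} \<in> finite_pairs I m"
  shows "a \<in> I" and "b \<in> I" and "m a b = m b a"
proof -
  obtain a' b' where ab: "{a, b} = {a', b'}" "a' \<in> I" "b' \<in> I" "a' \<noteq> b'"
    using assms(2) unfolding finite_pairs_def by blast
  then show I: "a \<in> I" "b \<in> I" by (auto simp: doubleton_eq_iff)
  have "a \<noteq> b" using ab by (auto simp: doubleton_eq_iff)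
  then show "m a b = m b a" using assms(1) I unfolding coxeter_matrix_def by blast
qed

lemma braid_word_in_lists:
  assumes "coxeter_matrix I m" and "{a, b} \<in> finite_pairs I m"
  shows "braid_word m a b \<in> lists I"
  using finite_pairs_memD[OF assms] by (simp add: braid_word_def alternating_word_in_lists)

lemma length_braid_word_commute:
  assumes "coxeter_matrix I m" and "{a, b} \<in> finite_pairs I m"
  shows "length (braid_word m a b) = length (braid_word m b a)"
  using finite_pairs_memD[OF assms] by (simp add: braid_word_def)

text \<open>
  Membership of an unordered pair only says that one of its two orderings has a short braid word.
  Both braid words have the same length, so the ordering does not matter.
\<close>
lemma finite_pairs_less_iff:
  assumes "coxeter_matrix I m"
  shows "{a, b} \<in> finite_pairs_less I m k \<longleftrightarrow>
    {a, b} \<in> finite_pairs I m \<and> enat (length (braid_word m a b)) < k"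
proof
  assume "{a, b} \<in> finite_pairs_less I m k"
  then obtain a' b' where ab: "{a, b} = {a', b'}" "{a', b'} \<in> finite_pairs I m"
    "enat (length (braid_word m a' b')) < k"
    unfolding finite_pairs_less_def by blast
  then have "length (braid_word m a b) = length (braid_word m a' b')"
    using length_braid_word_commute[OF assms ab(2)] by (auto simp: doubleton_eq_iff)
  then show "{a, b} \<in> finite_pairs I m \<and> enat (length (braid_word m a b)) < k"
    using ab by simp
qed (auto simp: finite_pairs_less_def)

lemma braid_moveI:
  "x \<in> lists I \<Longrightarrow> y \<in> lists I \<Longrightarrow> {a, b} \<in> finite_pairs I m \<Longrightarrow>
    (x @ braid_word m a b @ y, x @ braid_word m b a @ y) \<in> braid_move I m"
  unfolding braid_move_def by blast

lemma braid_moveE: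
  assumes "(w, w') \<in> braid_move I m"
  obtains x y a b where "x \<in> lists I" "y \<in> lists I" "{a, b} \<in> finite_pairs I m"
    "{b, a} \<in> finite_pairs I m" "w = x @ braid_word m a b @ y" "w' = x @ braid_word m b a @ y"
proof -
  obtain x y a b where "x \<in> lists I" "y \<in> lists I" "{a, b} \<in> finite_pairs I m"
    "w = x @ braid_word m a b @ y" "w' = x @ braid_word m b a @ y"
    using assms unfolding braid_move_def by blast
  moreover have "{b, a} = {a, b}" by blast
  ultimately show thesis using that by simp
qed

lemma braid_move_sym: "sym (braid_move I m)"
  by (rule symI) (auto elim!: braid_moveE intro!: braid_moveI)

lemma braid_move_in_lists:
  assumes "coxeter_matrix I m" and "(w, w') \<in> braid_move I m"
  shows "w' \<in> lists I" and "length w' = length w"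
proof -
  obtain x y a b where w: "x \<in> lists I" "y \<in> lists I" "{a, b} \<in> finite_pairs I m"
    "{b, a} \<in> finite_pairs I m" "w = x @ braid_word m a b @ y" "w' = x @ braid_word m b a @ y"
    using assms(2) by (rule braid_moveE)
  show "w' \<in> lists I"
    using w braid_word_in_lists[OF assms(1) w(4)] by simp
  show "length w' = length w"
    using w length_braid_word_commute[OF assms(1) w(3)] by simp
qed

lemma braid_move_append:
  assumes "(w, w') \<in> braid_move I m" and "u \<in> lists I"
  shows "(u @ w, u @ w') \<in> braid_move I m" and "(w @ u, w' @ u) \<in> braid_move I m"
proof -
  obtain x y a b where x: "x \<in> lists I" and y: "y \<in> lists I" and ab: "{a, b} \<in> finite_pairs I m"
    and w: "w = x @ braid_word m a b @ y" "w' = x @ braid_word m b a @ y"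
    using assms(1) by (rule braid_moveE)
  show "(u @ w, u @ w') \<in> braid_move I m"
    using braid_moveI[of "u @ x" I y, OF _ _ ab] x y assms(2) unfolding w by simp
  show "(w @ u, w' @ u) \<in> braid_move I m"
    using braid_moveI[of x I "y @ u", OF _ _ ab] x y assms(2) unfolding w by simp
qed

lemma nonvanishing_word_sublist:
  "nonvanishing_word I m d k w \<Longrightarrow> sublist v w \<Longrightarrow> nonvanishing_word I m d k v"
  unfolding nonvanishing_word_def
  by (meson sublist_order.order.trans)

lemma braid_stableD:
  assumes "braid_stable I m d k D"
  shows "finite D" and "D \<subseteq> lists I"
    and "(w, w') \<in> braid_move I m \<Longrightarrow> w \<in> D \<Longrightarrow> w' \<in> D"
    and "w \<in> D \<Longrightarrow> nonvanishing_word I m d k w"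
  using assms unfolding braid_stable_def by blast+

text \<open>
  A braid move inside \<open>v\<close> is a braid move inside \<open>u @ v\<close>, and a substring of \<open>v\<close> is a
  substring of \<open>u @ v\<close>. Stable sets are considered instead of single classes because the
  quotient of a class by a word may be a union of several classes.
\<close>
lemma braid_stable_left_quotient:
  assumes D: "braid_stable I m d k D"
  shows "braid_stable I m d k {v. u @ v \<in> D}"
  unfolding braid_stable_def
proof (intro conjI ballI allI impI)
  have "finite ((\<lambda>v. u @ v) -` D)"
    using braid_stableD(1)[OF D] by (intro finite_vimageI) (auto simp: inj_def)
  then show "finite {v. u @ v \<in> D}" by (simp add: vimage_def)
  have in_lists: "u \<in> lists I" "v \<in> lists I" if "u @ v \<in> D" for v
    using braid_stableD(2)[OF D] that by auto
  show "{v. u @ v \<in> D} \<subseteq> lists I" using in_lists(2) by (intro subsetI) simp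
  fix v assume v: "v \<in> {v. u @ v \<in> D}"
  show "nonvanishing_word I m d k v"
    using nonvanishing_word_sublist[OF braid_stableD(4)[OF D]] v by auto
  fix w assume "(v, w) \<in> braid_move I m"
  then show "w \<in> {v. u @ v \<in> D}"
    using braid_stableD(3)[OF D braid_move_append(1)[OF _ in_lists(1)]] v by simp
qed

lemma braid_stable_right_quotient:
  assumes D: "braid_stable I m d k D"
  shows "braid_stable I m d k {v. v @ u \<in> D}"
  unfolding braid_stable_def
proof (intro conjI ballI allI impI)
  have "finite ((\<lambda>v. v @ u) -` D)"
    using braid_stableD(1)[OF D] by (intro finite_vimageI) (auto simp: inj_def)
  then show "finite {v. v @ u \<in> D}" by (simp add: vimage_def)
  have in_lists: "u \<in> lists I" "v \<in> lists I" if "v @ u \<in> D" for v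
    using braid_stableD(2)[OF D] that by auto
  show "{v. v @ u \<in> D} \<subseteq> lists I" using in_lists(2) by (intro subsetI) simp
  fix v assume v: "v \<in> {v. v @ u \<in> D}"
  show "nonvanishing_word I m d k v"
    using nonvanishing_word_sublist[OF braid_stableD(4)[OF D]] v by auto
  fix w assume "(v, w) \<in> braid_move I m"
  then show "w \<in> {v. v @ u \<in> D}"
    using braid_stableD(3)[OF D braid_move_append(2)[OF _ in_lists(1)]] v by simp
qed

section \<open>Coefficient sums over braid-stable sets\<close>

definition stable_sum_kernel ::
  "('k, 'q) ring_scheme \<Rightarrow> 'i set \<Rightarrow> ('i \<Rightarrow> 'i \<Rightarrow> enat) \<Rightarrow> ('i \<Rightarrow> nat) \<Rightarrow> enat
     \<Rightarrow> ('i list \<Rightarrow> 'k) set" where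
  "stable_sum_kernel R I m d k =
     {f \<in> carrier (free_algebra R I). \<forall>D. braid_stable I m d k D \<longrightarrow> finsum R f D = \<zero>\<^bsub>R\<^esub>}"

context cring
begin

text \<open>
  Only the words of \<open>D\<close> that begin with \<open>u\<close> contribute, and cancelling the prefix
  \<open>u\<close> reindexes them.
\<close>
lemma finsum_convolution_monomial_left:
  assumes D: "finite D" and c: "c \<in> carrier R" and g: "\<And>w. g w \<in> carrier R"
  shows "finsum R (convolution R (monomial R c u) g) D = c \<otimes> finsum R g {v. u @ v \<in> D}"
proof -
  have inj: "inj_on ((@) u) {v. u @ v \<in> D}" by (simp add: inj_on_def)
  have "finsum R (convolution R (monomial R c u) g) D
      = finsum R (\<lambda>w. c \<otimes> g (drop (length u) w)) ((@) u ` {v. u @ v \<in> D})"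
    using D c g
    by (intro add.finprod_mono_neutral_cong_right)
       (auto simp: convolution_monomial_left prefix_def image_iff)
  also have "\<dots> = finsum R (\<lambda>v. c \<otimes> g (drop (length u) (u @ v))) {v. u @ v \<in> D}"
    using c g by (intro finsum_reindex inj) simp
  also have "\<dots> = c \<otimes> finsum R g {v. u @ v \<in> D}"
  proof -
    have "finite ((@) u -` D)" using D by (intro finite_vimageI) (simp_all add: inj_def)
    then have "finite {v. u @ v \<in> D}" by (simp add: vimage_def)
    then show ?thesis using c g by (simp add: finsum_rdistr)
  qed
  finally show ?thesis .
qed

lemma finsum_convolution_monomial_right:
  assumes D: "finite D" and c: "c \<in> carrier R" and g: "\<And>w. g w \<in> carrier R"
  shows "finsum R (convolution R g (monomial R c u)) D = finsum R g {v. v @ u \<in> D} \<otimes> c"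
proof -
  have inj: "inj_on (\<lambda>v. v @ u) {v. v @ u \<in> D}" by (simp add: inj_on_def)
  have "finsum R (convolution R g (monomial R c u)) D
      = finsum R (\<lambda>w. g (take (length w - length u) w) \<otimes> c) ((\<lambda>v. v @ u) ` {v. v @ u \<in> D})"
    using D c g
    by (intro add.finprod_mono_neutral_cong_right)
       (auto simp: convolution_monomial_right suffix_def image_iff)
  also have "\<dots> = finsum R (\<lambda>v. g (take (length (v @ u) - length u) (v @ u)) \<otimes> c) {v. v @ u \<in> D}"
    using c g by (intro finsum_reindex inj) simp
  also have "\<dots> = finsum R g {v. v @ u \<in> D} \<otimes> c"
  proof -
    have "finite ((\<lambda>v. v @ u) -` D)" using D by (intro finite_vimageI) (simp_all add: inj_def)
    then have "finite {v. v @ u \<in> D}" by (simp add: vimage_def)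
    then show ?thesis using c g by (simp add: finsum_ldistr)
  qed
  finally show ?thesis .
qed

lemma finsum_monomial:
  assumes "finite D" and "c \<in> carrier R"
  shows "finsum R (monomial R c u) D = (if u \<in> D then c else \<zero>)"
proof (cases "u \<in> D")
  case True
  then show ?thesis
    using finsum_singleton[of u D "\<lambda>_. c"] assms by (simp add: monomial_def eq_commute[of u])
next
  case False
  then have "finsum R (monomial R c u) D = finsum R (\<lambda>_. \<zero>) D"
    using assms by (intro finsum_cong') (auto simp: monomial_def)
  then show ?thesis using False by simp
qed

text \<open>
  Closure under multiplication by a monomial follows from the stability of left and right quotients
  of stable sets; the general case follows by additivity.
\<close>
lemma stable_sum_kernel_ideal: "ideal (stable_sum_kernel R I m d k) (free_algebra R I)"
proof (rule idealI)
  interpret A: ring "free_algebra R I" by (rule free_algebra_ring)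
  show "ring (free_algebra R I)" by (rule free_algebra_ring)
  have zero: "\<zero>\<^bsub>free_algebra R I\<^esub> \<in> stable_sum_kernel R I m d k"
    by (simp add: stable_sum_kernel_def) (simp add: free_algebra_simps)
  have finsum_add: "finsum R (f \<oplus>\<^bsub>free_algebra R I\<^esub> g) D = finsum R f D \<oplus> finsum R g D"
    if "f \<in> carrier (free_algebra R I)" "g \<in> carrier (free_algebra R I)" for f g D
    unfolding free_algebra_simps(5)
    using free_algebra_valued[OF that(1)] free_algebra_valued[OF that(2)]
    by (intro finsum_addf) auto
  have add: "f \<oplus>\<^bsub>free_algebra R I\<^esub> g \<in> stable_sum_kernel R I m d k"
    if "f \<in> stable_sum_kernel R I m d k" "g \<in> stable_sum_kernel R I m d k" for f g
    using that by (simp add: stable_sum_kernel_def finsum_add)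
  have neg: "\<ominus>\<^bsub>free_algebra R I\<^esub> f \<in> stable_sum_kernel R I m d k"
    if "f \<in> stable_sum_kernel R I m d k" for f
  proof -
    have f: "f \<in> carrier (free_algebra R I)" and f0: "\<And>D. braid_stable I m d k D \<Longrightarrow> finsum R f D = \<zero>"
      using that by (auto simp: stable_sum_kernel_def)
    have "finsum R (\<ominus>\<^bsub>free_algebra R I\<^esub> f) D = \<zero>" if D: "braid_stable I m d k D" for D
    proof -
      have "finsum R (\<ominus>\<^bsub>free_algebra R I\<^esub> f) D \<in> carrier R"
        using free_algebra_valued[OF A.a_inv_closed[OF f]] by (intro finsum_closed) auto
      moreover have "finsum R (\<ominus>\<^bsub>free_algebra R I\<^esub> f) D \<oplus> finsum R f D = \<zero>"
        using finsum_add[OF A.a_inv_closed[OF f] f, of D] A.l_neg[OF f]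
        by (simp add: free_algebra_simps(4))
      ultimately show ?thesis by (simp add: f0[OF D])
    qed
    then show ?thesis using f by (simp add: stable_sum_kernel_def)
  qed
  show "subgroup (stable_sum_kernel R I m d k) (add_monoid (free_algebra R I))"
    using zero add neg
    by unfold_locales (auto simp: stable_sum_kernel_def a_inv_def[symmetric])
  fix f x assume f: "f \<in> stable_sum_kernel R I m d k" and x: "x \<in> carrier (free_algebra R I)"
  have fA: "f \<in> carrier (free_algebra R I)" and fR: "\<And>w. f w \<in> carrier R"
    using f free_algebra_valued by (auto simp: stable_sum_kernel_def)
  show "x \<otimes>\<^bsub>free_algebra R I\<^esub> f \<in> stable_sum_kernel R I m d k"
    using x
  proof (induction x rule: free_algebra_induct)
    case zero
    then show ?case
      using A.l_null[OF fA] \<open>\<zero>\<^bsub>free_algebra R I\<^esub> \<in> stable_sum_kernel R I m d k\<close>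
      by (simp add: free_algebra_simps(4))
  next
    case (add_monomial g c u)
    have mon: "monomial R c u \<in> carrier (free_algebra R I)"
      by (rule monomial_in_free_algebra[OF add_monomial.hyps(2,3)])
    have "finsum R (monomial R c u \<otimes>\<^bsub>free_algebra R I\<^esub> f) D = \<zero>" if D: "braid_stable I m d k D" for D
      using f braid_stable_left_quotient[OF D, of u] add_monomial.hyps(2)
      by (simp add: free_algebra_simps(2) finsum_convolution_monomial_left braid_stableD(1)[OF D] fR
          stable_sum_kernel_def)
    then have "monomial R c u \<otimes>\<^bsub>free_algebra R I\<^esub> f \<in> stable_sum_kernel R I m d k"
      using A.m_closed[OF mon fA] by (simp add: stable_sum_kernel_def)
    then show ?case
      using add[OF _ add_monomial.IH] A.l_distr[OF mon add_monomial.hyps(1) fA] by simp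
  qed
  show "f \<otimes>\<^bsub>free_algebra R I\<^esub> x \<in> stable_sum_kernel R I m d k"
    using x
  proof (induction x rule: free_algebra_induct)
    case zero
    then show ?case
      using A.r_null[OF fA] \<open>\<zero>\<^bsub>free_algebra R I\<^esub> \<in> stable_sum_kernel R I m d k\<close>
      by (simp add: free_algebra_simps(4))
  next
    case (add_monomial g c u)
    have mon: "monomial R c u \<in> carrier (free_algebra R I)"
      by (rule monomial_in_free_algebra[OF add_monomial.hyps(2,3)])
    have "finsum R (f \<otimes>\<^bsub>free_algebra R I\<^esub> monomial R c u) D = \<zero>" if D: "braid_stable I m d k D" for D
      using f braid_stable_right_quotient[OF D, of u] add_monomial.hyps(2)
      by (simp add: free_algebra_simps(2) finsum_convolution_monomial_right braid_stableD(1)[OF D] fR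
          stable_sum_kernel_def)
    then have "f \<otimes>\<^bsub>free_algebra R I\<^esub> monomial R c u \<in> stable_sum_kernel R I m d k"
      using A.m_closed[OF fA mon] by (simp add: stable_sum_kernel_def)
    then show ?case
      using add[OF _ add_monomial.IH] A.r_distr[OF mon add_monomial.hyps(1) fA] by simp
  qed
qed

end

section \<open>Braid classes of words\<close>

lemma braid_equivalent_in_lists:
  assumes "coxeter_matrix I m" and "(w, w') \<in> (braid_move I m)\<^sup>*" and "w \<in> lists I"
  shows "w' \<in> lists I" and "length w' = length w"
  using assms(2)
proof (induction rule: rtrancl_induct)
  case base
  { case 1 show ?case by (rule assms(3)) next case 2 show ?case by simp }
next
  case (step v w')
  { case 1 show ?case using braid_move_in_lists(1)[OF assms(1) step.hyps(2)] .
  next case 2 show ?case using braid_move_in_lists(2)[OF assms(1) step.hyps(2)] step.IH(2) by simp }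
qed

text \<open>
  The reflexive transitive closure is reflexive on all words, not only on words over \<open>I\<close>, so it
  is no equivalence relation on \<^term>\<open>lists I\<close> in the sense of the quotient construction.
  Symmetry and transitivity suffice to let every member of a class generate it.
\<close>
lemma braid_class_eq_Image:
  assumes "C \<in> braid_classes I m" and "w \<in> C"
  shows "C = (braid_move I m)\<^sup>* `` {w}"
proof -
  obtain v where C: "C = (braid_move I m)\<^sup>* `` {v}"
    using assms(1) unfolding braid_classes_def by (rule quotientE)
  then have vw: "(v, w) \<in> (braid_move I m)\<^sup>*" using assms(2) by simp
  then have wv: "(w, v) \<in> (braid_move I m)\<^sup>*"
    using sym_rtrancl[OF braid_move_sym] by (rule symD[rotated])
  show ?thesis
    unfolding C using rtrancl_trans[OF vw] rtrancl_trans[OF wv] by blast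
qed

lemma braid_class_subset_lists:
  assumes "coxeter_matrix I m" and "C \<in> braid_classes I m"
  shows "C \<subseteq> lists I"
proof -
  obtain v where "v \<in> lists I" "C = (braid_move I m)\<^sup>* `` {v}"
    using assms(2) unfolding braid_classes_def by (rule quotientE)
  then show ?thesis using braid_equivalent_in_lists(1)[OF assms(1)] by blast
qed

lemma braid_class_disjoint:
  assumes "C \<in> braid_classes I m" and "C' \<in> braid_classes I m" and "w \<in> C" and "w \<in> C'"
  shows "C = C'"
  using braid_class_eq_Image[OF assms(1,3)] braid_class_eq_Image[OF assms(2,4)] by simp

lemma admissible_classes_eq:
  "admissible_classes I m d k = {C \<in> braid_classes I m. \<forall>w\<in>C. nonvanishing_word I m d k w}"
  by (simp add: admissible_classes_def nonvanishing_word_def)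

text \<open>
  Finiteness holds since braid moves preserve the length and the alphabet is finite.
\<close>
lemma admissible_class_braid_stable:
  assumes "coxeter_matrix I m" and "finite I" and "C \<in> admissible_classes I m d k"
  shows "braid_stable I m d k C"
proof -
  have C: "C \<in> braid_classes I m" "\<And>w. w \<in> C \<Longrightarrow> nonvanishing_word I m d k w"
    using assms(3) unfolding admissible_classes_eq by blast+
  obtain v where v: "v \<in> lists I" "C = (braid_move I m)\<^sup>* `` {v}"
    using C(1) unfolding braid_classes_def by (rule quotientE)
  have "C \<subseteq> {w. set w \<subseteq> I \<and> length w = length v}"
  proof
    fix w assume "w \<in> C"
    then have "(v, w) \<in> (braid_move I m)\<^sup>*" using v by simp
    from braid_equivalent_in_lists[OF assms(1) this v(1)]
    show "w \<in> {w. set w \<subseteq> I \<and> length w = length v}" by auto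
  qed
  then have "finite C" using finite_lists_length_eq[OF assms(2)] by (rule finite_subset)
  moreover have "w' \<in> C" if "(w, w') \<in> braid_move I m" "w \<in> C" for w w'
    using that v(2) rtrancl_into_rtrancl[of v w "braid_move I m" w'] by simp
  ultimately show ?thesis
    using C(2) braid_class_subset_lists[OF assms(1) C(1)] unfolding braid_stable_def by simp
qed


section \<open>The nil-Hecke ideal\<close>

locale nil_hecke_presentation = cring R for R (structure) +
  fixes I :: "'i set" and m :: "'i \<Rightarrow> 'i \<Rightarrow> enat" and d :: "'i \<Rightarrow> nat" and k :: enat
  assumes coxeter: "coxeter_matrix I m"
begin

abbreviation "A \<equiv> free_algebra R I"
abbreviation "J\<^sub>0 \<equiv> finite_pairs_less I m k"
abbreviation "K \<equiv> nil_hecke_ideal R I m d J\<^sub>0"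

interpretation A: ring A by (rule free_algebra_ring)

lemma braid_word_in_free_algebra:
  "{a, b} \<in> finite_pairs I m \<Longrightarrow> free_word R (braid_word m a b) \<in> carrier A"
  by (rule free_word_in_free_algebra[OF braid_word_in_lists[OF coxeter]])

text \<open>
  The conditions on a pair of being short or long are turned into conditions on the length of the
  given braid word, and the short case also records the reversed pair.
\<close>
lemma relator_cases:
  assumes "r \<in> nil_hecke_relators R I m d J\<^sub>0"
  obtains (nilpotent) i where "i \<in> I" "r = free_word R (replicate (d i) i)"
  | (braid) a b where "{a, b} \<in> finite_pairs I m" "{b, a} \<in> finite_pairs I m"
      "r = free_word R (braid_word m a b) \<ominus>\<^bsub>A\<^esub> free_word R (braid_word m b a)"
  | (long) a b where "{a, b} \<in> finite_pairs I m" "k \<le> enat (length (braid_word m a b))"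
      "r = free_word R (braid_word m a b)"
proof -
  consider i where "i \<in> I" "r = free_word R (replicate (d i) i)"
    | a b where "{a, b} \<in> J\<^sub>0"
        "r = free_word R (braid_word m a b) \<ominus>\<^bsub>A\<^esub> free_word R (braid_word m b a)"
    | a b where "{a, b} \<in> finite_pairs I m" "{a, b} \<notin> J\<^sub>0" "r = free_word R (braid_word m a b)"
    using assms unfolding nil_hecke_relators_def by blast
  then show thesis
  proof cases
    case 1 then show ?thesis by (rule nilpotent)
  next
    case (2 a b)
    then have "{a, b} \<in> finite_pairs I m" using finite_pairs_less_iff[OF coxeter] by blast
    moreover have "{b, a} = {a, b}" by (rule insert_commute)
    ultimately show ?thesis using braid 2(2) by simp
  next
    case (3 a b)
    then have "k \<le> enat (length (braid_word m a b))"
      using finite_pairs_less_iff[OF coxeter, of a b k] by (simp add: not_less)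
    then show ?thesis using long 3 by blast
  qed
qed

lemma relators_subset: "nil_hecke_relators R I m d J\<^sub>0 \<subseteq> carrier A"
proof
  fix r assume "r \<in> nil_hecke_relators R I m d J\<^sub>0"
  then show "r \<in> carrier A"
  proof (cases rule: relator_cases)
    case (nilpotent i)
    then have "replicate (d i) i \<in> lists I" by (auto simp: in_lists_conv_set)
    then show ?thesis using nilpotent(2) free_word_in_free_algebra by simp
  next
    case (braid a b)
    then show ?thesis using braid_word_in_free_algebra by simp
  next
    case (long a b)
    then show ?thesis using braid_word_in_free_algebra by simp
  qed
qed

lemma nil_hecke_ideal_is_ideal: "ideal K A"
  unfolding nil_hecke_ideal_def by (rule A.genideal_ideal[OF relators_subset])

lemma relators_in_ideal: "nil_hecke_relators R I m d J\<^sub>0 \<subseteq> K"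
  unfolding nil_hecke_ideal_def by (rule A.genideal_self[OF relators_subset])

interpretation K: ideal K A by (rule nil_hecke_ideal_is_ideal)

text \<open>
  This is where independence comes from: a coefficient sum over a stable set is a linear functional
  on the quotient. It suffices to check the relators. A stable set avoids the words that are set to
  zero, and it contains both or neither of the two braid words of a pair.
\<close>
lemma nil_hecke_ideal_subset_kernel: "K \<subseteq> stable_sum_kernel R I m d k"
  unfolding nil_hecke_ideal_def
proof (rule A.genideal_minimal[OF stable_sum_kernel_ideal], rule subsetI)
  fix r assume r: "r \<in> nil_hecke_relators R I m d J\<^sub>0"
  have fsum: "finsum R (free_word R u) D = (if u \<in> D then \<one> else \<zero>)"
    if "braid_stable I m d k D" for u :: "'i list" and D
    using finsum_monomial[OF braid_stableD(1)[OF that] one_closed] by (simp add: free_word_eq_monomial)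
  have "finsum R r D = \<zero>" if D: "braid_stable I m d k D" for D
    using r
  proof (cases rule: relator_cases)
    case (nilpotent i)
    then have "replicate (d i) i \<notin> D"
      using braid_stableD(4)[OF D] unfolding nonvanishing_word_def by blast
    then show ?thesis using nilpotent fsum[OF D] by simp
  next
    case (long a b)
    then have "braid_word m a b \<notin> D"
      using braid_stableD(4)[OF D] unfolding nonvanishing_word_def by blast
    then show ?thesis using long fsum[OF D] by simp
  next
    case (braid a b)
    have ba: "free_word R (braid_word m a b) \<in> carrier A" "free_word R (braid_word m b a) \<in> carrier A"
      using braid braid_word_in_free_algebra by simp_all
    have move: "(braid_word m a b, braid_word m b a) \<in> braid_move I m"
      using braid_moveI[of "[]" I "[]" a b m] braid(1) by simp
    then have "braid_word m a b \<in> D \<longleftrightarrow> braid_word m b a \<in> D"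
      using braid_stableD(3)[OF D] symD[OF braid_move_sym] by blast
    then have eq: "finsum R (free_word R (braid_word m a b)) D = finsum R (free_word R (braid_word m b a)) D"
      by (simp add: fsum[OF D])
    have "r \<in> carrier A" using r relators_subset by blast
    have "finsum R r D \<oplus> finsum R (free_word R (braid_word m b a)) D
        = finsum R (r \<oplus>\<^bsub>A\<^esub> free_word R (braid_word m b a)) D"
      unfolding free_algebra_simps(5)
      using free_algebra_valued[OF \<open>r \<in> carrier A\<close>] free_algebra_valued[OF ba(2)]
      by (intro finsum_addf[symmetric]) auto
    also have "r \<oplus>\<^bsub>A\<^esub> free_word R (braid_word m b a) = free_word R (braid_word m a b)"
      unfolding braid(3) a_minus_def using ba by (subst A.a_assoc) (simp_all add: A.l_neg)
    finally have "finsum R r D \<oplus> finsum R (free_word R (braid_word m a b)) D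
        = finsum R (free_word R (braid_word m a b)) D" by (simp only: eq)
    moreover have "finsum R r D \<in> carrier R"
      using free_algebra_valued[OF \<open>r \<in> carrier A\<close>] by (intro finsum_closed) auto
    moreover have "finsum R (free_word R (braid_word m a b)) D \<in> carrier R"
      using free_algebra_valued[OF ba(1)] by (intro finsum_closed) auto
    ultimately show ?thesis using add.r_cancel_one by blast
  qed
  then show "r \<in> stable_sum_kernel R I m d k"
    using r relators_subset unfolding stable_sum_kernel_def by blast
qed

lemma free_word_sandwich_in_ideal:
  assumes "free_word R u \<in> K" and "x \<in> lists I" and "y \<in> lists I"
  shows "free_word R (x @ u @ y) \<in> K"
proof -
  have "free_word R x \<otimes>\<^bsub>A\<^esub> (free_word R u \<otimes>\<^bsub>A\<^esub> free_word R y) \<in> K"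
    using assms by (intro K.I_l_closed K.I_r_closed free_word_in_free_algebra)
  then show ?thesis by (simp only: free_word_append)
qed

lemma long_braid_word_in_ideal:
  assumes "{a, b} \<in> finite_pairs I m" and "k \<le> enat (length (braid_word m a b))"
  shows "free_word R (braid_word m a b) \<in> K"
proof -
  have "{a, b} \<in> finite_pairs I m - J\<^sub>0"
    using assms finite_pairs_less_iff[OF coxeter, of a b k] by simp
  then show ?thesis using relators_in_ideal unfolding nil_hecke_relators_def by blast
qed

lemma vanishing_word_in_ideal:
  assumes "w \<in> lists I" and "\<not> nonvanishing_word I m d k w"
  shows "free_word R w \<in> K"
proof -
  obtain u where u: "sublist u w" "free_word R u \<in> K"
  proof -
    consider i where "i \<in> I" "sublist (replicate (d i) i) w"
      | a b where "{a, b} \<in> finite_pairs I m" "k \<le> enat (length (braid_word m a b))"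
          "sublist (braid_word m a b) w"
      using assms(2) unfolding nonvanishing_word_def by blast
    then show thesis
    proof cases
      case (1 i)
      then have "free_word R (replicate (d i) i) \<in> K"
        using relators_in_ideal unfolding nil_hecke_relators_def by blast
      then show ?thesis using that 1 by blast
    next
      case (2 a b)
      then show ?thesis using that long_braid_word_in_ideal by blast
    qed
  qed
  then obtain x y where "w = x @ u @ y" by (auto simp: sublist_def)
  then show ?thesis using free_word_sandwich_in_ideal[OF u(2)] assms(1) by simp
qed

lemma coset_free_word_mult:
  assumes "u \<in> lists I" and "v \<in> lists I"
  shows "rcoset_mult A K (K +>\<^bsub>A\<^esub> free_word R u) (K +>\<^bsub>A\<^esub> free_word R v)
    = K +>\<^bsub>A\<^esub> free_word R (u @ v)"
  using K.rcoset_mult_add[OF free_word_in_free_algebra[OF assms(1)] free_word_in_free_algebra[OF assms(2)]]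
  by (simp only: free_word_append)

text \<open>
  For a short braid relation the difference of the two braid words is a relator, and for a long
  one both braid words lie in the ideal; the remaining letters only multiply by cosets.
\<close>
lemma braid_move_coset_eq:
  assumes "(w, w') \<in> braid_move I m"
  shows "K +>\<^bsub>A\<^esub> free_word R w = K +>\<^bsub>A\<^esub> free_word R w'"
proof -
  obtain x y a b where w: "x \<in> lists I" "y \<in> lists I" "{a, b} \<in> finite_pairs I m"
    "{b, a} \<in> finite_pairs I m" "w = x @ braid_word m a b @ y" "w' = x @ braid_word m b a @ y"
    using assms by (rule braid_moveE)
  let ?v = "free_word R (braid_word m a b)" and ?w = "free_word R (braid_word m b a)"
  have vw: "?v \<in> carrier A" "?w \<in> carrier A"
    using w braid_word_in_free_algebra by simp_all
  have "?v \<ominus>\<^bsub>A\<^esub> ?w \<in> K"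
  proof (cases "enat (length (braid_word m a b)) < k")
    case True
    then have "{a, b} \<in> J\<^sub>0" using w(3) finite_pairs_less_iff[OF coxeter, of a b k] by simp
    then show ?thesis using relators_in_ideal unfolding nil_hecke_relators_def by blast
  next
    case False
    then have "?v \<in> K" "?w \<in> K"
      using w(3,4) long_braid_word_in_ideal length_braid_word_commute[OF coxeter w(3)]
      by (simp_all add: not_less)
    then have "K +>\<^bsub>A\<^esub> ?v = K +>\<^bsub>A\<^esub> ?w" by (simp add: K.a_rcos_const)
    then show ?thesis using coset_eq_iff_diff_mem[OF nil_hecke_ideal_is_ideal vw] by simp
  qed
  then have "K +>\<^bsub>A\<^esub> ?v = K +>\<^bsub>A\<^esub> ?w"
    using coset_eq_iff_diff_mem[OF nil_hecke_ideal_is_ideal vw] by simp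
  moreover have "K +>\<^bsub>A\<^esub> free_word R (x @ u @ y) = rcoset_mult A K (K +>\<^bsub>A\<^esub> free_word R x)
      (rcoset_mult A K (K +>\<^bsub>A\<^esub> free_word R u) (K +>\<^bsub>A\<^esub> free_word R y))" if "u \<in> lists I" for u
  proof -
    have "u @ y \<in> lists I" using that w(2) by simp
    then show ?thesis by (simp only: coset_free_word_mult w(1,2) that)
  qed
  ultimately show ?thesis
    unfolding w(5,6) by (simp only: braid_word_in_lists[OF coxeter] w(3,4))
qed

lemma braid_class_coset_eq:
  assumes "C \<in> braid_classes I m" and "w \<in> C" and "w' \<in> C"
  shows "K +>\<^bsub>A\<^esub> free_word R w = K +>\<^bsub>A\<^esub> free_word R w'"
proof -
  have "(w, w') \<in> (braid_move I m)\<^sup>*" using braid_class_eq_Image[OF assms(1,2)] assms(3) by simp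
  then show ?thesis
    by (induction rule: rtrancl_induct) (simp_all add: braid_move_coset_eq)
qed

lemma nil_hecke_monomial_eq_coset:
  assumes "w \<in> lists I"
  shows "nil_hecke_monomial R I m d J\<^sub>0 w = K +>\<^bsub>A\<^esub> free_word R w"
  using assms
proof (induction w)
  case Nil
  then show ?case
    by (simp add: nil_hecke_monomial_def nil_hecke_def quotient_algebra_simps(3)
        free_algebra_simps(3) free_word_eq_monomial)
next
  case (Cons i w)
  then have "[i] \<in> lists I" "w \<in> lists I" by simp_all
  from coset_free_word_mult[OF this] show ?case
    using Cons
    by (simp add: nil_hecke_monomial_def nil_hecke_def nil_hecke_gen_def quotient_algebra_simps(2))
qed


section \<open>Normal forms\<close>

text \<open>
  It is enough to treat a single word. If its class is admissible, the word is congruent to the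
  chosen representative. Otherwise some equivalent word has a forbidden substring, and the word is
  congruent to zero.
\<close>
lemma normal_form_exists:
  assumes rep: "\<forall>C\<in>admissible_classes I m d k. rep C \<in> C" and "f \<in> carrier A"
  shows "\<exists>g\<in>carrier A. K +>\<^bsub>A\<^esub> f = K +>\<^bsub>A\<^esub> g \<and>
    {w. g w \<noteq> \<zero>} \<subseteq> rep ` admissible_classes I m d k"
  using assms(2)
proof (induction f rule: free_algebra_induct)
  case zero
  show ?case using A.zero_closed by (intro bexI[of _ "\<zero>\<^bsub>A\<^esub>"]) (auto simp: free_algebra_simps(4))
next
  case (add_monomial f c u)
  obtain g where g: "g \<in> carrier A" "K +>\<^bsub>A\<^esub> f = K +>\<^bsub>A\<^esub> g"
    "{w. g w \<noteq> \<zero>} \<subseteq> rep ` admissible_classes I m d k"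
    using add_monomial.IH by blast
  have u: "u \<in> lists I" by fact
  have c: "c \<in> carrier R" by fact
  have uA: "free_word R u \<in> carrier A" by (rule free_word_in_free_algebra[OF u])
  have "\<exists>h\<in>carrier A. K +>\<^bsub>A\<^esub> free_word R u = K +>\<^bsub>A\<^esub> h \<and>
      {w. h w \<noteq> \<zero>} \<subseteq> rep ` admissible_classes I m d k"
  proof -
    define C where "C = (braid_move I m)\<^sup>* `` {u}"
    have C: "C \<in> braid_classes I m" "u \<in> C"
      using u unfolding C_def braid_classes_def by (blast intro: quotientI)+
    show ?thesis
    proof (cases "C \<in> admissible_classes I m d k")
      case True
      then have "rep C \<in> C" using rep by blast
      then have "rep C \<in> lists I" using braid_class_subset_lists[OF coxeter C(1)] by blast
      then have "free_word R (rep C) \<in> carrier A" by (rule free_word_in_free_algebra)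
      moreover have "K +>\<^bsub>A\<^esub> free_word R u = K +>\<^bsub>A\<^esub> free_word R (rep C)"
        using C \<open>rep C \<in> C\<close> by (rule braid_class_coset_eq)
      moreover have "{w. free_word R (rep C) w \<noteq> \<zero>} \<subseteq> rep ` admissible_classes I m d k"
        using True by (auto simp: free_word_def)
      ultimately show ?thesis by blast
    next
      case False
      then obtain w where w: "w \<in> C" "\<not> nonvanishing_word I m d k w"
        using C(1) unfolding admissible_classes_eq by blast
      have "w \<in> lists I" using w(1) braid_class_subset_lists[OF coxeter C(1)] by blast
      then have "free_word R w \<in> K" using w(2) by (rule vanishing_word_in_ideal)
      then have "K +>\<^bsub>A\<^esub> free_word R u = K"
        using braid_class_coset_eq[OF C w(1)] K.a_rcos_const by simp
      also have "K = K +>\<^bsub>A\<^esub> \<zero>\<^bsub>A\<^esub>" by (rule coset_zero[OF nil_hecke_ideal_is_ideal, symmetric])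
      finally show ?thesis
        using A.zero_closed by (intro bexI[of _ "\<zero>\<^bsub>A\<^esub>"]) (simp_all add: free_algebra_simps(4))
    qed
  qed
  then obtain h where h: "h \<in> carrier A" "K +>\<^bsub>A\<^esub> free_word R u = K +>\<^bsub>A\<^esub> h"
    "{w. h w \<noteq> \<zero>} \<subseteq> rep ` admissible_classes I m d k" by blast
  have ch: "c \<odot>\<^bsub>A\<^esub> h \<in> carrier A" using c h(1) by (rule free_algebra_smult_closed)
  have "K +>\<^bsub>A\<^esub> monomial R c u = K +>\<^bsub>A\<^esub> (c \<odot>\<^bsub>A\<^esub> free_word R u)"
    by (simp only: smult_free_word[OF c])
  also have "\<dots> = K +>\<^bsub>A\<^esub> (c \<odot>\<^bsub>A\<^esub> h)"
    using quotient_algebra_smult[OF nil_hecke_ideal_is_ideal c uA] quotient_algebra_smult[OF nil_hecke_ideal_is_ideal c h(1)]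
    by (simp only: h(2))
  finally have "K +>\<^bsub>A\<^esub> (monomial R c u \<oplus>\<^bsub>A\<^esub> f) = K +>\<^bsub>A\<^esub> (c \<odot>\<^bsub>A\<^esub> h \<oplus>\<^bsub>A\<^esub> g)"
    using g(2) quotient_algebra_add[OF nil_hecke_ideal_is_ideal ch g(1)]
      quotient_algebra_add[OF nil_hecke_ideal_is_ideal monomial_in_free_algebra[OF c u] add_monomial.hyps(1)]
    by simp
  moreover have "{w. (c \<odot>\<^bsub>A\<^esub> h \<oplus>\<^bsub>A\<^esub> g) w \<noteq> \<zero>} \<subseteq> {w. h w \<noteq> \<zero>} \<union> {w. g w \<noteq> \<zero>}"
    using c by (auto simp: free_algebra_simps)
  ultimately show ?case
    using A.a_closed[OF ch g(1)] g(3) h(3) by blast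
qed

lemma lincomb_free_words_apply:
  assumes "finite F" and "c \<in> F \<rightarrow> carrier R" and "rep \<in> F \<rightarrow> lists I" and "inj_on rep F"
  shows "(\<Oplus>\<^bsub>A\<^esub>x\<in>F. c x \<odot>\<^bsub>A\<^esub> free_word R (rep x)) \<in> carrier A"
    and "x \<in> F \<Longrightarrow> (\<Oplus>\<^bsub>A\<^esub>x\<in>F. c x \<odot>\<^bsub>A\<^esub> free_word R (rep x)) (rep x) = c x"
    and "w \<notin> rep ` F \<Longrightarrow> (\<Oplus>\<^bsub>A\<^esub>x\<in>F. c x \<odot>\<^bsub>A\<^esub> free_word R (rep x)) w = \<zero>"
proof -
  have summand: "c x \<odot>\<^bsub>A\<^esub> free_word R (rep x) \<in> carrier A"
    "c x \<odot>\<^bsub>A\<^esub> free_word R (rep x) = monomial R (c x) (rep x)" if "x \<in> F" for x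
  proof -
    have cr: "c x \<in> carrier R" "rep x \<in> lists I" using that assms(2,3) by blast+
    show "c x \<odot>\<^bsub>A\<^esub> free_word R (rep x) \<in> carrier A"
      by (rule free_algebra_smult_closed[OF cr(1) free_word_in_free_algebra[OF cr(2)]])
    show "c x \<odot>\<^bsub>A\<^esub> free_word R (rep x) = monomial R (c x) (rep x)"
      by (rule smult_free_word[OF cr(1)])
  qed
  show "(\<Oplus>\<^bsub>A\<^esub>x\<in>F. c x \<odot>\<^bsub>A\<^esub> free_word R (rep x)) \<in> carrier A"
    using summand(1) by (intro A.finsum_closed) blast
  have eval: "(\<Oplus>\<^bsub>A\<^esub>x\<in>F. c x \<odot>\<^bsub>A\<^esub> free_word R (rep x)) w = (\<Oplus>x\<in>F. monomial R (c x) (rep x) w)" for w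
    using assms(1) summand assms(2)
  proof (induction F)
    case empty
    show ?case by (simp add: free_algebra_simps(4))
  next
    case (insert x F)
    have "(\<lambda>x. c x \<odot>\<^bsub>A\<^esub> free_word R (rep x)) \<in> F \<rightarrow> carrier A" using insert.prems(1) by blast
    moreover have "c x \<odot>\<^bsub>A\<^esub> free_word R (rep x) \<in> carrier A" using insert.prems(1) by blast
    moreover have "(\<lambda>x. monomial R (c x) (rep x) w) \<in> insert x F \<rightarrow> carrier R"
      using insert.prems(3) by (auto intro!: monomial_closed)
    moreover have "(\<Oplus>\<^bsub>A\<^esub>x\<in>F. c x \<odot>\<^bsub>A\<^esub> free_word R (rep x)) w = (\<Oplus>x\<in>F. monomial R (c x) (rep x) w)"
      using insert.prems by (intro insert.IH) blast+
    ultimately show ?case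
      using insert.hyps insert.prems(2)[of x]
      by (simp add: A.finsum_insert finsum_insert) (simp add: free_algebra_simps(5))
  qed
  show "(\<Oplus>\<^bsub>A\<^esub>x\<in>F. c x \<odot>\<^bsub>A\<^esub> free_word R (rep x)) (rep x) = c x" if "x \<in> F"
  proof -
    have "(\<Oplus>y\<in>F. monomial R (c y) (rep y) (rep x)) = (\<Oplus>y\<in>F. if x = y then c y else \<zero>)"
      using assms(2) that inj_onD[OF assms(4)]
      by (intro finsum_cong') (auto simp: monomial_def)
    then show ?thesis
      using finsum_singleton[OF that assms(1,2)] by (simp only: eval)
  qed
  show "(\<Oplus>\<^bsub>A\<^esub>x\<in>F. c x \<odot>\<^bsub>A\<^esub> free_word R (rep x)) w = \<zero>" if "w \<notin> rep ` F"
  proof -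
    have "(\<Oplus>y\<in>F. monomial R (c y) (rep y) w) = (\<Oplus>y\<in>F. \<zero>)"
      using that by (intro finsum_cong') (auto simp: monomial_def)
    then show ?thesis by (simp add: eval)
  qed
qed


end

theorem theorem2p4:
  fixes R :: "('k, 'q) ring_scheme"
    and I :: "'i set"
    and m :: "'i \<Rightarrow> 'i \<Rightarrow> enat"
    and d :: "'i \<Rightarrow> nat"
    and k :: enat
    and rep :: "'i list set \<Rightarrow> 'i list"
  assumes "cring R"
    and "finite I"
    and "coxeter_matrix I m"
    and "\<forall>i\<in>I. 2 \<le> d i"
    and "1 \<le> k"
    and "\<forall>C\<in>admissible_classes I m d k. rep C \<in> C"
  shows "free_basis R (nil_hecke R I m d (finite_pairs_less I m k))
           (admissible_classes I m d k)
           (\<lambda>C. nil_hecke_monomial R I m d (finite_pairs_less I m k) (rep C))"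
proof -
  interpret cring R by fact
  interpret nil_hecke_presentation R I m d k by unfold_locales fact
  let ?S = "admissible_classes I m d k" and ?H = "quotient_algebra A K"
  let ?mon = "\<lambda>C. nil_hecke_monomial R I m d J\<^sub>0 (rep C)"
  have S: "C \<in> braid_classes I m" "rep C \<in> C" "rep C \<in> lists I" if "C \<in> ?S" for C
  proof -
    show C: "C \<in> braid_classes I m" "rep C \<in> C" using that assms(6) unfolding admissible_classes_eq by blast+
    then show "rep C \<in> lists I" using braid_class_subset_lists[OF assms(3)] by blast
  qed
  have inj: "inj_on rep ?S"
  proof (rule inj_onI)
    fix C C' assume C: "C \<in> ?S" "C' \<in> ?S" "rep C = rep C'"
    then have "rep C \<in> C'" using S(2)[OF C(2)] by simp
    then show "C = C'" by (rule braid_class_disjoint[OF S(1)[OF C(1)] S(1)[OF C(2)] S(2)[OF C(1)]])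
  qed
  \<comment> \<open>Questions about combinations of monomials in the quotient are moved to the free algebra.\<close>
  have lincomb: "(\<Oplus>\<^bsub>?H\<^esub>C\<in>F. c C \<odot>\<^bsub>?H\<^esub> ?mon C)
      = K +>\<^bsub>A\<^esub> (\<Oplus>\<^bsub>A\<^esub>C\<in>F. c C \<odot>\<^bsub>A\<^esub> free_word R (rep C))"
    if F: "finite F" "F \<subseteq> ?S" "c \<in> F \<rightarrow> carrier R" for F c
  proof -
    interpret H: abelian_monoid ?H by (rule quotient_algebra_abelian_monoid[OF nil_hecke_ideal_is_ideal])
    have fw: "free_word R (rep C) \<in> carrier A" if "C \<in> F" for C
      using F(2) that by (intro free_word_in_free_algebra S(3)) blast
    have mon: "?mon C = K +>\<^bsub>A\<^esub> free_word R (rep C)" if "C \<in> F" for C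
      using F(2) that by (intro nil_hecke_monomial_eq_coset S(3)) blast
    have cl: "c C \<odot>\<^bsub>?H\<^esub> (K +>\<^bsub>A\<^esub> free_word R (rep C)) \<in> carrier ?H" if "C \<in> F" for C
    proof -
      have "c C \<in> carrier R" using F(3) that by blast
      then show ?thesis
        using fw[OF that] free_algebra_smult_closed[OF \<open>c C \<in> carrier R\<close> fw[OF that]]
        by (simp add: quotient_algebra_smult[OF nil_hecke_ideal_is_ideal] quotient_algebra_carrier)
    qed
    have "(\<Oplus>\<^bsub>?H\<^esub>C\<in>F. c C \<odot>\<^bsub>?H\<^esub> ?mon C)
        = (\<Oplus>\<^bsub>?H\<^esub>C\<in>F. c C \<odot>\<^bsub>?H\<^esub> (K +>\<^bsub>A\<^esub> free_word R (rep C)))"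
      using cl by (intro H.finsum_cong') (simp_all add: mon)
    also have "\<dots> = K +>\<^bsub>A\<^esub> (\<Oplus>\<^bsub>A\<^esub>C\<in>F. c C \<odot>\<^bsub>A\<^esub> free_word R (rep C))"
      using fw by (intro quotient_algebra_lincomb[OF nil_hecke_ideal_is_ideal F(1,3)]) blast
    finally show ?thesis .
  qed
  have coeff_lincomb: "(\<Oplus>\<^bsub>A\<^esub>C\<in>F. c C \<odot>\<^bsub>A\<^esub> free_word R (rep C)) \<in> carrier A"
    "C \<in> F \<Longrightarrow> (\<Oplus>\<^bsub>A\<^esub>C\<in>F. c C \<odot>\<^bsub>A\<^esub> free_word R (rep C)) (rep C) = c C"
    "w \<notin> rep ` F \<Longrightarrow> (\<Oplus>\<^bsub>A\<^esub>C\<in>F. c C \<odot>\<^bsub>A\<^esub> free_word R (rep C)) w = \<zero>\<^bsub>R\<^esub>"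
    if F: "finite F" "F \<subseteq> ?S" "c \<in> F \<rightarrow> carrier R" for F c C w
  proof -
    have "rep \<in> F \<rightarrow> lists I" using F(2) S(3) by blast
    note * = lincomb_free_words_apply[OF F(1,3) this inj_on_subset[OF inj F(2)]]
    show "(\<Oplus>\<^bsub>A\<^esub>C\<in>F. c C \<odot>\<^bsub>A\<^esub> free_word R (rep C)) \<in> carrier A" by (rule *(1))
    show "C \<in> F \<Longrightarrow> (\<Oplus>\<^bsub>A\<^esub>C\<in>F. c C \<odot>\<^bsub>A\<^esub> free_word R (rep C)) (rep C) = c C" by (rule *(2))
    show "w \<notin> rep ` F \<Longrightarrow> (\<Oplus>\<^bsub>A\<^esub>C\<in>F. c C \<odot>\<^bsub>A\<^esub> free_word R (rep C)) w = \<zero>\<^bsub>R\<^esub>" by (rule *(3))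
  qed
  have "?mon C \<in> carrier ?H" if "C \<in> ?S" for C
    using nil_hecke_monomial_eq_coset[OF S(3)[OF that]] free_word_in_free_algebra[OF S(3)[OF that]]
    by (simp add: quotient_algebra_carrier)
  moreover have "c C = \<zero>\<^bsub>R\<^esub>"
    if F: "finite F" "F \<subseteq> ?S" "c \<in> F \<rightarrow> carrier R"
      and zero: "(\<Oplus>\<^bsub>?H\<^esub>C\<in>F. c C \<odot>\<^bsub>?H\<^esub> ?mon C) = \<zero>\<^bsub>?H\<^esub>" and C: "C \<in> F" for F c C
  proof -
    let ?f = "\<Oplus>\<^bsub>A\<^esub>C\<in>F. c C \<odot>\<^bsub>A\<^esub> free_word R (rep C)"
    have CS: "C \<in> ?S" using C F(2) by blast
    have stable: "braid_stable I m d k C"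
      using assms(3,2) CS by (rule admissible_class_braid_stable)
    have "?f \<in> K"
      using zero lincomb[OF F] coset_eq_ideal_iff[OF nil_hecke_ideal_is_ideal coeff_lincomb(1)[OF F]]
      by (simp add: quotient_algebra_simps(4))
    then have "finsum R ?f C = \<zero>\<^bsub>R\<^esub>"
      using nil_hecke_ideal_subset_kernel stable unfolding stable_sum_kernel_def by blast
    moreover have "finsum R ?f C = c C"
    proof -
      \<comment> \<open>Classes are disjoint, so no representative of another class lies in \<open>C\<close>.\<close>
      have off: "?f w = \<zero>\<^bsub>R\<^esub>" if "w \<in> C" "w \<noteq> rep C" for w
      proof (rule coeff_lincomb(3)[OF F], rule notI)
        assume "w \<in> rep ` F"
        then obtain C' where C': "C' \<in> F" "w = rep C'" by blast
        then have "C' \<in> ?S" using F(2) by blast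
        then have "C' = C"
          using braid_class_disjoint[OF S(1) S(1)[OF CS] S(2), of C'] that(1) C'(2) by simp
        then show False using that(2) C'(2) by simp
      qed
      have cC: "c C \<in> carrier R" using F(3) C by blast
      have "finsum R ?f C = (\<Oplus>\<^bsub>R\<^esub>w\<in>C. if rep C = w then c C else \<zero>\<^bsub>R\<^esub>)"
        using off coeff_lincomb(2)[OF F C] cC by (intro finsum_cong') auto
      also have "\<dots> = c C"
        using finsum_singleton[OF S(2)[OF CS] braid_stableD(1)[OF stable], of "\<lambda>_. c C"] cC by simp
      finally show ?thesis .
    qed
    ultimately show ?thesis by simp
  qed
  moreover have "\<exists>F c. finite F \<and> F \<subseteq> ?S \<and> c \<in> F \<rightarrow> carrier R
      \<and> y = (\<Oplus>\<^bsub>?H\<^esub>C\<in>F. c C \<odot>\<^bsub>?H\<^esub> ?mon C)" if y: "y \<in> carrier ?H" for y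
  proof -
    obtain f where f: "f \<in> carrier A" "y = K +>\<^bsub>A\<^esub> f"
      using y by (auto simp: quotient_algebra_carrier)
    obtain g where g: "g \<in> carrier A" "K +>\<^bsub>A\<^esub> f = K +>\<^bsub>A\<^esub> g" "{w. g w \<noteq> \<zero>\<^bsub>R\<^esub>} \<subseteq> rep ` ?S"
      using normal_form_exists[OF assms(6) f(1)] by blast
    \<comment> \<open>The coordinates of \<open>y\<close> are the coefficients of the normal form \<open>g\<close> at the representatives.\<close>
    define F where "F = {C \<in> ?S. g (rep C) \<noteq> \<zero>\<^bsub>R\<^esub>}"
    have "rep ` F \<subseteq> {w. g w \<noteq> \<zero>\<^bsub>R\<^esub>}" by (auto simp: F_def)
    moreover have "finite {w. g w \<noteq> \<zero>\<^bsub>R\<^esub>}" using g(1) by (simp add: free_algebra_simps(1))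
    ultimately have "finite (rep ` F)" by (rule finite_subset)
    moreover have "inj_on rep F" by (rule inj_on_subset[OF inj]) (auto simp: F_def)
    ultimately have F: "finite F" "F \<subseteq> ?S" "(\<lambda>C. g (rep C)) \<in> F \<rightarrow> carrier R"
      using free_algebra_valued[OF g(1)] by (auto simp: F_def dest: finite_imageD)
    have "(\<Oplus>\<^bsub>A\<^esub>C\<in>F. g (rep C) \<odot>\<^bsub>A\<^esub> free_word R (rep C)) = g"
    proof
      fix w
      show "(\<Oplus>\<^bsub>A\<^esub>C\<in>F. g (rep C) \<odot>\<^bsub>A\<^esub> free_word R (rep C)) w = g w"
      proof (cases "w \<in> rep ` F")
        case True
        then show ?thesis using coeff_lincomb(2)[OF F] by blast
      next
        case False
        then have "g w = \<zero>\<^bsub>R\<^esub>" using g(3) by (auto simp: F_def)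
        then show ?thesis using coeff_lincomb(3)[OF F False] by simp
      qed
    qed
    then have "y = (\<Oplus>\<^bsub>?H\<^esub>C\<in>F. g (rep C) \<odot>\<^bsub>?H\<^esub> ?mon C)"
      using lincomb[OF F] f(2) g(2) by simp
    then show ?thesis using F by blast
  qed
  ultimately show ?thesis
    unfolding free_basis_def nil_hecke_def by blast
qed

end
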